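(* Let $(X,T)$ be a minimal topological dynamical system. Then the following statements are equivalent: (1) $(X,T)$ is $\mathcal{F}_{ts}$-sensitive; (2) $(X,T)$ is $\mathcal{F}_t$-sensitive; (3) $(X,T)$ is $\mathcal{F}_{ip}$-sensitive; (4) $(X,T)$ is $\mathcal{F}_{fip}$-sensitive; (5) $(X,T)$ is $\mathcal{F}_{f\Delta}$-sensitive; (6) there exists $\delta>0$ such that for every $x\in X$ there is $y\in X$ such that $(x,y)$ is regionally proximal and $d(x,y)>\delta$; (7) the factor map from $(X,T)$ to its maximal equicontinuous factor $X_{eq}$ is not almost one-to-one.
   Context: A topological dynamical system $(X,T)$: compact metric space $(X,d)$, $T$ continuous surjective; minimal means every orbit is dense. For $\delta>0$ and nonempty open $U$, $N(\delta,U)=\{n\in\mathbb{N}:\operatorname{diam}(T^nU)>\delta\}$. For a family $\mathcal{F}$ of subsets of $\mathbb{Z}_+$ (closed under taking supersets), $(X,T)$ is $\mathcal{F}$-sensitive if there is $\delta>0$ with $N(\delta,U)\in\mathcal{F}$ for every nonempty open $U$. Families: $\mathcal{F}_t$ = thick sets (containing arbitrarily long intervals of consecutive integers); a set is syndetic if it has bounded gaps, piecewise syndetic if it is the intersection of a syndetic and a thick set, and thickly syndetic if it meets every piecewise syndetic set; $\mathcal{F}_{ts}$ = thickly syndetic sets; $\mathcal{F}_{ip}$ = sets containing $FS((p_i)_{i=1}^\infty)=\{\sum_{i\in\alpha}p_i:\alpha$ finite nonempty$\}$ for some $p_i\in\mathbb{N}$; $\mathcal{F}_{fip}$ = sets containing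 finite IP-sets $FS((p_i)_{i=1}^n)$ of arbitrarily long length $n$; for a set $E\subset\mathbb{Z}_+$, $\Delta(E)=\{a-b:a\ge b,\ a,b\in E\}$, and $\mathcal{F}_{f\Delta}$ = sets containing $\Delta(E)$ for finite sets $E$ of arbitrarily large cardinality. A pair $(x_1,x_2)$ is regionally proximal if for every $\varepsilon>0$ and neighborhoods $U_i$ of $x_i$ there are $x_i'\in U_i$ and $n\in\mathbb{N}$ with $d(T^nx_1',T^nx_2')<\varepsilon$. $X_{eq}$ is the maximal equicontinuous factor. A factor map $\pi$ is almost one-to-one if $\{x:\pi^{-1}(\pi(x))=\{x\}\}$ is dense.
   Formalization: In (5), Δ(E) is taken as {a−b : a>b, a,b∈E} instead of a≥b: with a≥b, 0 always lies in Δ(E) but never in N(δ,U) for small U, so (5) could never hold and the equivalence would fail, e.g. for nontrivial weakly mixing minimal systems. *)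

theory Defs
  imports "HOL-Analysis.Analysis"
begin

definition tds :: "'a::metric_space set \<Rightarrow> ('a \<Rightarrow> 'a) \<Rightarrow> bool" where
  "tds X T \<longleftrightarrow> compact X \<and> X \<noteq> {} \<and> continuous_on X T \<and> T ` X = X"

definition minimal_sys :: "'a::metric_space set \<Rightarrow> ('a \<Rightarrow> 'a) \<Rightarrow> bool" where
  "minimal_sys X T \<longleftrightarrow> (\<forall>x\<in>X. X \<subseteq> closure {(T ^^ n) x | n. True})"

definition Nset :: "('a::metric_space \<Rightarrow> 'a) \<Rightarrow> real \<Rightarrow> 'a set \<Rightarrow> nat set" where
  "Nset T \<delta> U = {n. n \<ge> 1 \<and> diameter ((T ^^ n) ` U) > \<delta>}"

definition F_sensitive :: "'a::metric_space set \<Rightarrow> ('a \<Rightarrow> 'a) \<Rightarrow> (nat set \<Rightarrow> bool) \<Rightarrow> bool" where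
  "F_sensitive X T F \<longleftrightarrow>
     (\<exists>\<delta>>0. \<forall>U. openin (top_of_set X) U \<and> U \<noteq> {} \<longrightarrow> F (Nset T \<delta> U))"

definition thick :: "nat set \<Rightarrow> bool" where
  "thick A \<longleftrightarrow> (\<forall>L. \<exists>m. {m..<m+L} \<subseteq> A)"

definition syndetic :: "nat set \<Rightarrow> bool" where
  "syndetic A \<longleftrightarrow> (\<exists>L>0. \<forall>m. \<exists>k\<in>A. m \<le> k \<and> k < m + L)"

definition piecewise_syndetic :: "nat set \<Rightarrow> bool" where
  "piecewise_syndetic A \<longleftrightarrow> (\<exists>S Th. syndetic S \<and> thick Th \<and> A = S \<inter> Th)"

definition thickly_syndetic :: "nat set \<Rightarrow> bool" where
  "thickly_syndetic A \<longleftrightarrow> (\<forall>P. piecewise_syndetic P \<longrightarrow> A \<inter> P \<noteq> {})"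

definition ip_family :: "nat set \<Rightarrow> bool" where
  "ip_family A \<longleftrightarrow>
     (\<exists>p::nat \<Rightarrow> nat. (\<forall>i. p i > 0) \<and> {sum p \<alpha> | \<alpha>. finite \<alpha> \<and> \<alpha> \<noteq> {}} \<subseteq> A)"

definition fip_family :: "nat set \<Rightarrow> bool" where
  "fip_family A \<longleftrightarrow>
     (\<forall>n. \<exists>p::nat \<Rightarrow> nat. (\<forall>i<n. p i > 0) \<and> {sum p \<alpha> | \<alpha>. \<alpha> \<subseteq> {..<n} \<and> \<alpha> \<noteq> {}} \<subseteq> A)"

definition Delta :: "nat set \<Rightarrow> nat set" where
  "Delta E = {a - b | a b. a \<in> E \<and> b \<in> E \<and> a > b}"

definition fDelta_family :: "nat set \<Rightarrow> bool" where
  "fDelta_family A \<longleftrightarrow> (\<forall>n. \<exists>E. finite E \<and> card E \<ge> n \<and> Delta E \<subseteq> A)"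

definition regionally_proximal :: "'a::metric_space set \<Rightarrow> ('a \<Rightarrow> 'a) \<Rightarrow> 'a \<Rightarrow> 'a \<Rightarrow> bool" where
  "regionally_proximal X T x1 x2 \<longleftrightarrow> x1 \<in> X \<and> x2 \<in> X \<and>
     (\<forall>\<epsilon>>0. \<forall>U1 U2. openin (top_of_set X) U1 \<and> x1 \<in> U1 \<and> openin (top_of_set X) U2 \<and> x2 \<in> U2
        \<longrightarrow> (\<exists>x1'\<in>U1. \<exists>x2'\<in>U2. \<exists>n\<ge>1. dist ((T ^^ n) x1') ((T ^^ n) x2') < \<epsilon>))"

definition factor_map ::
  "'a::metric_space set \<Rightarrow> ('a \<Rightarrow> 'a) \<Rightarrow> 'b::metric_space set \<Rightarrow> ('b \<Rightarrow> 'b) \<Rightarrow> ('a \<Rightarrow> 'b) \<Rightarrow> bool" where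
  "factor_map X T Y S \<pi> \<longleftrightarrow> tds X T \<and> tds Y S \<and> continuous_on X \<pi> \<and> \<pi> ` X = Y \<and>
     (\<forall>x\<in>X. \<pi> (T x) = S (\<pi> x))"

definition equicontinuous_sys :: "'a::metric_space set \<Rightarrow> ('a \<Rightarrow> 'a) \<Rightarrow> bool" where
  "equicontinuous_sys Y S \<longleftrightarrow>
     (\<forall>\<epsilon>>0. \<exists>\<delta>>0. \<forall>x\<in>Y. \<forall>y\<in>Y. dist x y < \<delta> \<longrightarrow> (\<forall>n. dist ((S ^^ n) x) ((S ^^ n) y) < \<epsilon>))"

definition max_eq_factor ::
  "'a::metric_space set \<Rightarrow> ('a \<Rightarrow> 'a) \<Rightarrow> 'b::metric_space set \<Rightarrow> ('b \<Rightarrow> 'b) \<Rightarrow> ('a \<Rightarrow> 'b) \<Rightarrow> bool" where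
  "max_eq_factor X T Y S \<pi> \<longleftrightarrow> factor_map X T Y S \<pi> \<and> equicontinuous_sys Y S \<and>
     (\<forall>(Z::(nat \<Rightarrow> real) set) R \<phi>. factor_map X T Z R \<phi> \<and> equicontinuous_sys Z R \<longrightarrow>
        (\<exists>\<psi>. factor_map Y S Z R \<psi> \<and> (\<forall>x\<in>X. \<phi> x = \<psi> (\<pi> x))))"

definition almost_one_to_one :: "'a::metric_space set \<Rightarrow> ('a \<Rightarrow> 'b) \<Rightarrow> bool" where
  "almost_one_to_one X \<pi> \<longleftrightarrow> X \<subseteq> closure {x\<in>X. {x'\<in>X. \<pi> x' = \<pi> x} = {x}}"

end

theory Submission
  imports Defs
begin

text \<open>Everything hinges on one fact: if \<open>\<pi> x = \<pi> y\<close> and \<open>N \<subseteq> X \<times> X\<close> is closed and forward invariant, then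
  the rows \<open>N``{x}\<close> and \<open>N``{y}\<close> agree up to a null set. This is McMahon's argument with a finitely
  additive invariant mean in place of an invariant measure: the outer measure of a row is upper
  semicontinuous in \<open>x\<close> and nondecreasing along orbits, hence constant by minimality, so the measure
  of the symmetric difference of two rows is a continuous invariant pseudo-metric on \<open>X\<close>; its quotient
  is an equicontinuous factor, through which \<open>\<pi>\<close> must factor. Taking for \<open>N\<close> the pairs that never
  come close, or the closure of the forward orbit of a neighbourhood of the diagonal, one obtains
  that fibre pairs are regionally proximal, both forwards and backwards in time.

  If \<open>\<pi>\<close> is not almost one-to-one, all fibres are uniformly large. Either some fibre pair is not
  proximal, and pulling it back to a pair of close points gives arbitrarily long blocks of
  separation; or all finite subsets of fibres are proximal, and following a large fibre backwards
  until it is small gives the same. A limit argument with Baire's theorem upgrades thick to thickly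
  syndetic. Conversely, at a one-point fibre the return times of an equicontinuous system meet
  every long difference set, which rules out sensitivity along such sets.\<close>

section \<open>Ultrafilter limits and families of sets of integers\<close>

definition free_ultrafilter :: "nat filter \<Rightarrow> bool" where
  "free_ultrafilter F \<longleftrightarrow> F \<noteq> bot \<and> F \<le> sequentially \<and> (\<forall>P. eventually P F \<or> eventually (\<lambda>n. \<not> P n) F)"

text \<open>Zorn's lemma, for the reversed order on the proper filters below
  \<open>sequentially\<close>, gives a minimal one, and minimality makes it decide every
  predicate.\<close>

lemma free_ultrafilter_exists: "\<exists>F. free_ultrafilter F"
proof -
  define A where "A = {G :: nat filter. G \<noteq> bot \<and> G \<le> sequentially}"
  have "\<exists>M\<in>A. \<forall>G\<in>A. G \<le> M \<longrightarrow> G = M"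
  proof (rule predicate_Zorn)
    show "partial_order_on A (relation_of (\<lambda>G H. H \<le> G) A)"
      by (rule partial_order_on_relation_ofI) auto
  next
    fix C assume "C \<in> Chains (relation_of (\<lambda>G H. H \<le> G) A)"
    then have CA: "C \<subseteq> A" and chain: "\<And>G H. G \<in> C \<Longrightarrow> H \<in> C \<Longrightarrow> G \<le> H \<or> H \<le> G"
      by (auto simp: Chains_def relation_of_def)
    show "\<exists>u\<in>A. \<forall>a\<in>C. u \<le> a"
    proof (cases "C = {}")
      case True
      then show ?thesis by (auto simp: A_def intro!: exI[of _ sequentially])
    next
      case False
      \<comment> \<open>On a nonempty chain an event of the infimum is already an event of one
        member, so properness passes to the infimum.\<close>
      have "eventually P (Inf C) \<longleftrightarrow> (\<exists>b\<in>C. eventually P b)" for P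
        using False chain by (intro eventually_Inf_base) (auto simp: inf.absorb1 inf.absorb2)
      then have "Inf C \<noteq> bot"
        using CA by (auto simp: trivial_limit_def A_def)
      moreover have "Inf C \<le> sequentially"
        using False CA by (auto simp: A_def intro: Inf_lower2)
      ultimately show ?thesis
        by (intro bexI[of _ "Inf C"]) (auto simp: A_def intro: Inf_lower)
    qed
  qed
  then obtain M where M: "M \<in> A" "\<And>G. G \<in> A \<Longrightarrow> G \<le> M \<Longrightarrow> G = M" by blast
  have "eventually P M \<or> eventually (\<lambda>n. \<not> P n) M" for P
  proof (rule disjCI)
    assume *: "\<not> eventually (\<lambda>n. \<not> P n) M"
    \<comment> \<open>Adjoining \<open>P\<close> keeps the filter proper, as the negation of
      \<open>P\<close> is not eventual; minimality then puts \<open>P\<close> into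
      \<open>M\<close>.\<close>
    let ?G = "inf M (principal {n. P n})"
    have "?G \<noteq> bot"
      using * by (simp add: trivial_limit_def eventually_inf_principal)
    then have "?G \<in> A" using M(1) by (auto simp: A_def intro: le_infI1)
    then have "?G = M" by (rule M(2)) simp
    moreover have "eventually P ?G" by (simp add: eventually_inf_principal)
    ultimately show "eventually P M" by simp
  qed
  then show ?thesis using M(1) unfolding A_def free_ultrafilter_def by blast
qed

lemma free_ultrafilter_tail:
  assumes "free_ultrafilter F" "eventually P sequentially"
  shows "eventually P F"
  using assms filter_leD unfolding free_ultrafilter_def by blast

text \<open>Otherwise the finitely many negations would all hold eventually. This lets a choice that
  varies with \<open>n\<close> be replaced by one fixed choice.\<close>

lemma free_ultrafilter_disj_finite:
  assumes F: "free_ultrafilter F" and "finite I" "\<forall>\<^sub>F n in F. \<exists>i\<in>I. P i n"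
  shows "\<exists>i\<in>I. \<forall>\<^sub>F n in F. P i n"
proof (rule ccontr)
  assume "\<not> ?thesis"
  then have "\<forall>i\<in>I. \<forall>\<^sub>F n in F. \<not> P i n"
    using F unfolding free_ultrafilter_def by blast
  then have "\<forall>\<^sub>F n in F. \<forall>i\<in>I. \<not> P i n"
    using \<open>finite I\<close> by (simp add: eventually_ball_finite)
  with assms(3) have "\<forall>\<^sub>F n in F. False"
    by eventually_elim auto
  then show False
    using F unfolding free_ultrafilter_def by (simp add: trivial_limit_def)
qed

text \<open>Compactness gives a cluster point of the image filter, and an ultrafilter converges to
  each of its cluster points. Unlike subsequences, one \<open>F\<close> serves all sequences at
  once.\<close>

lemma free_ultrafilter_compact_limit:
  assumes F: "free_ultrafilter F" and K: "compact K" "\<And>n. f n \<in> K"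
  shows "\<exists>l\<in>K. (f \<longlongrightarrow> l) F"
proof -
  have "filtermap f F \<noteq> bot" "eventually (\<lambda>x. x \<in> K) (filtermap f F)"
    using F K(2) by (auto simp: filtermap_bot_iff free_ultrafilter_def eventually_filtermap)
  then obtain l where l: "l \<in> K" "inf (nhds l) (filtermap f F) \<noteq> bot"
    using K(1) unfolding compact_filter by blast
  have "(f \<longlongrightarrow> l) F"
  proof (rule topological_tendstoI)
    fix S assume S: "open S" "l \<in> S"
    show "\<forall>\<^sub>F n in F. f n \<in> S"
    proof (rule ccontr)
      assume "\<not> ?thesis"
      then have "\<forall>\<^sub>F n in F. f n \<notin> S"
        using F unfolding free_ultrafilter_def by blast
      then have "eventually (\<lambda>x. x \<notin> S) (filtermap f F)"
        by (simp add: eventually_filtermap)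
      moreover have "eventually (\<lambda>x. x \<in> S) (nhds l)"
        using S by (rule eventually_nhds_in_open)
      ultimately have "\<forall>\<^sub>F x in inf (nhds l) (filtermap f F). False"
        unfolding eventually_inf by (intro exI[of _ "\<lambda>x. x \<in> S"] exI[of _ "\<lambda>x. x \<notin> S"]) auto
      then show False using l(2) by (simp add: trivial_limit_def)
    qed
  qed
  then show ?thesis using l(1) by blast
qed

lemma compact_close_pair:
  fixes f :: "nat \<Rightarrow> 'a::metric_space"
  assumes "compact K" "\<And>n. f n \<in> K" "0 < \<epsilon>"
  obtains i j where "i < j" "dist (f i) (f j) < \<epsilon>"
proof -
  obtain l r where r: "strict_mono (r :: nat \<Rightarrow> nat)" "(f \<circ> r) \<longlonglongrightarrow> l"
    using assms(2) compact_imp_seq_compact[OF assms(1)] by (meson seq_compactE)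
  then have "Cauchy (f \<circ> r)"
    using LIMSEQ_imp_Cauchy by blast
  then obtain M where "\<And>m n. m \<ge> M \<Longrightarrow> n \<ge> M \<Longrightarrow> dist ((f \<circ> r) m) ((f \<circ> r) n) < \<epsilon>"
    using assms(3) unfolding Cauchy_def by blast
  then have "dist (f (r M)) (f (r (Suc M))) < \<epsilon>" by simp
  moreover have "r M < r (Suc M)" using r(1) by (simp add: strict_mono_Suc_iff)
  ultimately show thesis using that by blast
qed

text \<open>A finite Baire argument: if \<open>W\<close> sticks out of \<open>C i\<close>, then
  \<open>W - C i\<close> is still open and nonempty and is covered by the remaining sets.\<close>

lemma nonempty_open_in_finite_closed_cover:
  assumes "finite I" "\<And>i. i \<in> I \<Longrightarrow> closedin \<X> (C i)" "openin \<X> W" "W \<noteq> {}" "W \<subseteq> (\<Union>i\<in>I. C i)"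
  shows "\<exists>i\<in>I. \<exists>V. openin \<X> V \<and> V \<noteq> {} \<and> V \<subseteq> C i"
  using assms
proof (induction I arbitrary: W rule: finite_induct)
  case empty
  then show ?case by simp
next
  case (insert i I)
  show ?case
  proof (cases "W \<subseteq> C i")
    case True
    then show ?thesis using insert.prems by blast
  next
    case False
    have "openin \<X> (W - C i)"
      using insert.prems by (intro openin_diff) auto
    moreover have "W - C i \<noteq> {}" "W - C i \<subseteq> (\<Union>i\<in>I. C i)"
      using False insert.prems by auto
    ultimately have "\<exists>i\<in>I. \<exists>V. openin \<X> V \<and> V \<noteq> {} \<and> V \<subseteq> C i"
      using insert.IH insert.prems(1) by blast
    then show ?thesis by blast
  qed
qed

section \<open>Implications between the families of sets of integers\<close>

lemma thickly_syndetic_imp_thick: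
  assumes "thickly_syndetic A" shows "thick A"
proof (rule ccontr)
  assume "\<not> thick A"
  then obtain L where L: "\<And>m. \<not> {m..<m+L} \<subseteq> A" unfolding thick_def by blast
  \<comment> \<open>Every window of length \<open>L\<close> meets the complement of
    \<open>A\<close>, so the complement is syndetic and, with \<open>UNIV\<close> as the thick set,
    piecewise syndetic.\<close>
  have "syndetic (- A)"
    unfolding syndetic_def
  proof (intro exI[of _ "Suc L"] conjI allI)
    fix m
    obtain k where "k \<in> {m..<m+L}" "k \<notin> A" using L[of m] by blast
    then show "\<exists>k\<in>-A. m \<le> k \<and> k < m + Suc L" by (intro bexI[of _ k]) auto
  qed simp
  moreover have "thick UNIV" by (simp add: thick_def)
  ultimately have "piecewise_syndetic (- A)" unfolding piecewise_syndetic_def by blast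
  then show False using assms unfolding thickly_syndetic_def by blast
qed

lemma thick_shifted:
  assumes "thick A" shows "\<exists>m\<ge>k. {m..<m+L} \<subseteq> A"
proof -
  obtain m where "{m..<m+(k+L)} \<subseteq> A" using assms unfolding thick_def by blast
  then show ?thesis by (intro exI[of _ "m+k"]) auto
qed

text \<open>The generators are chosen so that \<open>p i\<close> starts an interval of
  \<open>A\<close> longer than the sum of all earlier ones; a finite sum is its last generator plus
  a remainder that stays inside this interval.\<close>

lemma thick_imp_ip_family:
  assumes "thick A" shows "ip_family A"
proof -
  define h where "h s = (SOME m. m \<ge> 1 \<and> {m..<m+Suc s} \<subseteq> A)" for s
  have h: "h s \<ge> 1" "{h s..<h s+Suc s} \<subseteq> A" for s
    using someI_ex[OF thick_shifted[OF assms, of 1 "Suc s"]] unfolding h_def by blast+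
  \<comment> \<open>\<open>s n\<close> is to be the sum of the first \<open>n\<close> generators; it
    is defined first because each generator depends on it.\<close>
  define s where "s = rec_nat 0 (\<lambda>_ t. t + h t)"
  have s0: "s 0 = 0" and sS: "\<And>n. s (Suc n) = s n + h (s n)" by (simp_all add: s_def)
  define p where "p i = h (s i)" for i
  have sum_p: "sum p {..<n} = s n" for n
    by (induction n) (simp_all add: s0 sS p_def)
  have "sum p \<alpha> \<in> A" if "finite \<alpha>" "\<alpha> \<noteq> {}" for \<alpha>
  proof -
    let ?m = "Max \<alpha>"
    have m: "?m \<in> \<alpha>" using that by simp
    have "sum p \<alpha> = p ?m + sum p (\<alpha> - {?m})"
      using that m by (simp add: sum.remove)
    moreover have "sum p (\<alpha> - {?m}) \<le> sum p {..<?m}"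
      using that by (intro sum_mono2) (auto simp: order_less_le)
    ultimately have "sum p \<alpha> \<in> {h (s ?m)..<h (s ?m)+Suc (s ?m)}"
      using sum_p by (simp add: p_def)
    then show ?thesis using h(2) by blast
  qed
  then show ?thesis
    unfolding ip_family_def using h(1) by (intro exI[of _ p]) (auto simp: p_def Suc_le_eq)
qed

lemma ip_family_imp_fip_family:
  assumes "ip_family A" shows "fip_family A"
proof -
  obtain p :: "nat \<Rightarrow> nat" where p: "\<And>i. p i > 0" "{sum p \<alpha> | \<alpha>. finite \<alpha> \<and> \<alpha> \<noteq> {}} \<subseteq> A"
    using assms unfolding ip_family_def by blast
  have "{sum p \<alpha> | \<alpha>. \<alpha> \<subseteq> {..<n} \<and> \<alpha> \<noteq> {}} \<subseteq> {sum p \<alpha> | \<alpha>. finite \<alpha> \<and> \<alpha> \<noteq> {}}" for n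
    using finite_subset[OF _ finite_lessThan] by blast
  then show ?thesis
    unfolding fip_family_def using p by (meson subset_trans)
qed

text \<open>Partial sums of the generators form the set: a difference of two of them is the sum over
  a block of consecutive indices, and positive generators make them distinct.\<close>

lemma fip_family_imp_fDelta_family:
  assumes "fip_family A" shows "fDelta_family A"
  unfolding fDelta_family_def
proof
  fix n
  obtain p :: "nat \<Rightarrow> nat" where p: "\<forall>i<n. p i > 0"
    and A: "{sum p \<alpha> | \<alpha>. \<alpha> \<subseteq> {..<n} \<and> \<alpha> \<noteq> {}} \<subseteq> A"
    using assms unfolding fip_family_def by (auto dest: spec[of _ n])
  define s where "s k = sum p {..<k}" for k
  have diff: "s k = s j + sum p {j..<k}" if "j \<le> k" for j k
    using that sum.atLeastLessThan_concat[of 0 j k p] unfolding s_def by (simp add: lessThan_atLeast0)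
  have less: "s j < s k" if "j < k" "k \<le> n" for j k
  proof -
    have "p j \<le> sum p {j..<k}" using that by (intro member_le_sum) auto
    moreover have "p j > 0" using p that by simp
    ultimately show ?thesis using diff[of j k] that by simp
  qed
  have "inj_on s {..<n}"
  proof (rule linorder_inj_onI')
    fix i j assume "j \<in> {..<n}" "i < j"
    then show "s i \<noteq> s j" using less[of i j] by simp
  qed
  moreover have "Delta (s ` {..<n}) \<subseteq> A"
  proof
    fix d assume "d \<in> Delta (s ` {..<n})"
    then obtain j k where jk: "d = s k - s j" "s j < s k" "j < n" "k < n"
      unfolding Delta_def by auto
    then have "j < k" using less[of k j] by (cases j k rule: linorder_cases) auto
    then have "d = sum p {j..<k}" using jk(1) diff[of j k] by simp
    moreover have "{j..<k} \<subseteq> {..<n}" "{j..<k} \<noteq> {}" using jk \<open>j < k\<close> by auto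
    ultimately show "d \<in> A" using A by blast
  qed
  ultimately show "\<exists>E. finite E \<and> n \<le> card E \<and> Delta E \<subseteq> A"
    by (intro exI[of _ "s ` {..<n}"]) (simp add: card_image)
qed

section \<open>Minimal systems and invariant means\<close>

lemma diameter_le_dist:
  fixes A :: "'a::metric_space set"
  assumes "0 \<le> d" "\<And>x y. x \<in> A \<Longrightarrow> y \<in> A \<Longrightarrow> dist x y \<le> d"
  shows "diameter A \<le> d"
proof (cases "A = {}")
  case False
  then have "(SUP (x,y)\<in>A\<times>A. dist x y) \<le> d"
    using assms(2) by (intro cSUP_least) auto
  then show ?thesis using False by (simp add: diameter_def)
qed (use assms(1) in simp)

locale minimal_tds =
  fixes X :: "'a::metric_space set" and T :: "'a \<Rightarrow> 'a"
  assumes tds: "tds X T" and minimal: "minimal_sys X T"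
begin

section \<open>Iterates and return times of a minimal system\<close>

lemma compact_X: "compact X" and X_nonempty: "X \<noteq> {}" and T_image: "T ` X = X"
  using tds by (auto simp: tds_def)

lemma iter_image: "(T ^^ n) ` X = X"
proof (induction n)
  case (Suc n)
  have "(T ^^ Suc n) ` X = T ` ((T ^^ n) ` X)" by (simp add: image_comp)
  then show ?case using Suc T_image by simp
qed simp

lemma iter_in: "x \<in> X \<Longrightarrow> (T ^^ n) x \<in> X"
  using iter_image by blast

lemma T_in: "x \<in> X \<Longrightarrow> T x \<in> X"
  using T_image by blast

lemma iter_cont: "continuous_on X (T ^^ n)"
proof (induction n)
  case 0
  show ?case by (simp add: id_def)
next
  case (Suc n)
  have "continuous_on ((T ^^ n) ` X) T"
    using tds by (simp add: iter_image tds_def)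
  then show ?case using continuous_on_compose[OF Suc] by simp
qed

lemma iter_tendsto:
  assumes "(f \<longlongrightarrow> l) F" "\<And>n. f n \<in> X" "l \<in> X"
  shows "((\<lambda>n. (T ^^ k) (f n)) \<longlongrightarrow> (T ^^ k) l) F"
  using continuous_on_tendsto_compose[OF iter_cont assms(1,3)] assms(2) by simp

lemma iter_modulus:
  assumes "0 < \<epsilon>"
  shows "\<exists>\<delta>>0. \<forall>k\<le>n. \<forall>x\<in>X. \<forall>y\<in>X. dist x y < \<delta> \<longrightarrow> dist ((T ^^ k) x) ((T ^^ k) y) < \<epsilon>"
proof -
  have "\<exists>d>0. \<forall>x\<in>X. \<forall>y\<in>X. dist x y < d \<longrightarrow> dist ((T ^^ k) x) ((T ^^ k) y) < \<epsilon>" for k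
    using compact_uniformly_continuous[OF iter_cont compact_X] assms
    unfolding uniformly_continuous_on_def by (metis dist_commute)
  then obtain d where d: "\<And>k. d k > 0"
    "\<And>k x y. x \<in> X \<Longrightarrow> y \<in> X \<Longrightarrow> dist x y < d k \<Longrightarrow> dist ((T ^^ k) x) ((T ^^ k) y) < \<epsilon>"
    by metis
  show ?thesis
  proof (intro exI[of _ "Min (d ` {..n})"] conjI allI impI ballI)
    show "0 < Min (d ` {..n})" using d(1) by simp
    fix k x y assume "k \<le> n" "x \<in> X" "y \<in> X" "dist x y < Min (d ` {..n})"
    then show "dist ((T ^^ k) x) ((T ^^ k) y) < \<epsilon>" using d(2)[of x y k] by simp
  qed
qed

lemma orbit_enters:
  assumes "openin (top_of_set X) U" "U \<noteq> {}" "x \<in> X"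
  shows "\<exists>n. (T ^^ n) x \<in> U"
proof -
  obtain O' where O': "open O'" "U = X \<inter> O'" using assms(1) openin_open by blast
  obtain u where "u \<in> X" "u \<in> O'" using assms(2) O' by blast
  then have "u \<in> closure {(T ^^ n) x | n. True}"
    using minimal assms(3) unfolding minimal_sys_def by blast
  then have "O' \<inter> {(T ^^ n) x | n. True} \<noteq> {}"
    using O'(1) \<open>u \<in> O'\<close> by (metis IntI empty_iff open_Int_closure_eq_empty)
  then show ?thesis using O'(2) iter_in[OF assms(3)] by blast
qed

lemma orbit_approaches:
  assumes "x \<in> X" "y \<in> X" "0 < \<epsilon>"
  shows "\<exists>n. dist y ((T ^^ n) x) < \<epsilon>"
proof -
  have "y \<in> X \<inter> ball y \<epsilon>" using assms by simp
  then obtain n where "(T ^^ n) x \<in> X \<inter> ball y \<epsilon>"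
    using orbit_enters[OF openin_open_Int[OF open_ball] _ assms(1)] by blast
  then show ?thesis by auto
qed

text \<open>By minimality the sets of points that are in \<open>U\<close> at time \<open>n\<close>
  cover \<open>X\<close>; take a finite subcover and its Lebesgue number. Whole sets
  \<open>A\<close> are treated because tight clusters of points later have to enter \<open>U\<close>
  under one common iterate.\<close>

lemma uniform_return_cover:
  assumes U: "openin (top_of_set X) U" "U \<noteq> {}"
  shows "\<exists>N::nat. \<exists>\<rho>>0. \<forall>A\<subseteq>X. A \<noteq> {} \<longrightarrow> (\<forall>a\<in>A. \<forall>b\<in>A. dist a b < \<rho>) \<longrightarrow> (\<exists>j<N. (T ^^ j) ` A \<subseteq> U)"
proof -
  have "\<exists>O'. open O' \<and> X \<inter> (T ^^ n) -` U = X \<inter> O'" for n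
  proof -
    have "(T ^^ n) ` X \<subseteq> X" by (simp add: iter_image)
    then have "openin (top_of_set X) (X \<inter> (T ^^ n) -` U)"
      using continuous_openin_preimage[OF iter_cont _ U(1)] by blast
    then show ?thesis by (simp add: openin_open)
  qed
  then obtain G where G: "\<And>n. open (G n)" "\<And>n. X \<inter> (T ^^ n) -` U = X \<inter> G n" by metis
  have "X \<subseteq> (\<Union>n. G n)"
    using orbit_enters[OF U] G(2) by blast
  then obtain C where C: "finite C" "X \<subseteq> (\<Union>n\<in>C. G n)"
    by (rule compactE_image[OF compact_X G(1)])
  then have "G ` C \<noteq> {}" using X_nonempty by blast
  then obtain \<delta> where \<delta>: "0 < \<delta>" "\<And>A. A \<subseteq> X \<Longrightarrow> diameter A < \<delta> \<Longrightarrow> \<exists>B\<in>G ` C. A \<subseteq> B"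
    using Lebesgue_number_lemma[OF compact_X, of "G ` C"] C(2) G(1) by (metis imageE)
  show ?thesis
  proof (rule exI[of _ "Suc (Max C)"], rule exI[of _ "\<delta>/2"], intro conjI allI impI)
    show "0 < \<delta>/2" using \<delta> by simp
    fix A assume A: "A \<subseteq> X" "A \<noteq> {}" "\<forall>a\<in>A. \<forall>b\<in>A. dist a b < \<delta>/2"
    have "diameter A \<le> \<delta>/2" using A(3) \<delta>(1) by (intro diameter_le_dist) (auto intro: less_imp_le)
    then have "diameter A < \<delta>" using \<delta>(1) by simp
    then obtain j where j: "j \<in> C" "A \<subseteq> G j" using \<delta>(2)[OF A(1)] by blast
    then have "(T ^^ j) ` A \<subseteq> U" using A(1) G(2)[of j] by blast
    moreover have "j < Suc (Max C)" using j(1) C(1) by (simp add: less_Suc_eq_le)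
    ultimately show "\<exists>j<Suc (Max C). (T ^^ j) ` A \<subseteq> U" by blast
  qed
qed

lemma uniform_return:
  assumes "openin (top_of_set X) U" "U \<noteq> {}"
  shows "\<exists>N::nat. \<forall>x\<in>X. \<exists>j<N. (T ^^ j) x \<in> U"
proof -
  obtain N \<rho> where N: "\<rho> > 0"
    "\<And>A. A \<subseteq> X \<Longrightarrow> A \<noteq> {} \<Longrightarrow> (\<forall>a\<in>A. \<forall>b\<in>A. dist a b < \<rho>) \<Longrightarrow> \<exists>j<N. (T ^^ j) ` A \<subseteq> U"
    using uniform_return_cover[OF assms] by metis
  show ?thesis using N(1) N(2)[of "{_}"] by (intro exI[of _ N]) auto
qed

lemma bounded_iter_image: "U \<subseteq> X \<Longrightarrow> bounded ((T ^^ n) ` U)"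
  using bounded_subset[OF compact_imp_bounded[OF compact_X]] image_mono[of U X "T ^^ n"]
  by (simp add: iter_image)

lemma dist_le_diameter_iter:
  assumes "U \<subseteq> X" "x \<in> U" "y \<in> U"
  shows "dist ((T ^^ n) x) ((T ^^ n) y) \<le> diameter ((T ^^ n) ` U)"
  using diameter_bounded_bound[OF bounded_iter_image[OF assms(1)]] assms by blast

lemma mem_Nset:
  assumes "U \<subseteq> X" "x \<in> U" "y \<in> U" "1 \<le> n" "\<delta> < dist ((T ^^ n) x) ((T ^^ n) y)"
  shows "n \<in> Nset T \<delta> U"
  using dist_le_diameter_iter[OF assms(1-3), of n] assms by (simp add: Nset_def)

lemma dense_sequence: "\<exists>s :: nat \<Rightarrow> 'a. range s \<subseteq> X \<and> (\<forall>x\<in>X. \<forall>\<epsilon>>0. \<exists>n. dist x (s n) < \<epsilon>)"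
proof -
  obtain x where "x \<in> X" using X_nonempty by blast
  then show ?thesis
    using iter_in orbit_approaches[of x] by (intro exI[of _ "\<lambda>n. (T ^^ n) x"]) auto
qed

end

text \<open>Averages of indicator functions along the orbit of \<open>z\<close>, taken to the limit
  along a free ultrafilter. Every subset of the type is measured, at the price of mere finite
  additivity.\<close>

lemma invariant_mean_exists:
  fixes T :: "'a \<Rightarrow> 'a" and z :: 'a
  shows "\<exists>\<nu> :: 'a set \<Rightarrow> real. (\<forall>A. 0 \<le> \<nu> A) \<and> (\<forall>A. range (\<lambda>n. (T ^^ n) z) \<subseteq> A \<longrightarrow> \<nu> A = 1) \<and>
    (\<forall>A B. A \<inter> B = {} \<longrightarrow> \<nu> (A \<union> B) = \<nu> A + \<nu> B) \<and> (\<forall>A. \<nu> (T -` A) = \<nu> A)"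
proof -
  obtain F where F: "free_ultrafilter F" using free_ultrafilter_exists by blast
  then have Fbot: "F \<noteq> bot" by (simp add: free_ultrafilter_def)
  define d where "d A n = (\<Sum>i<n. indicat_real A ((T ^^ i) z)) / n" for A n
  have d01: "d A n \<in> {0..1}" for A n
  proof -
    have "(\<Sum>i<n. indicat_real A ((T ^^ i) z)) \<le> (\<Sum>i<n. 1)"
      by (intro sum_mono) (simp add: indicator_def)
    then show ?thesis by (auto simp: d_def divide_le_eq intro!: divide_nonneg_nonneg sum_nonneg)
  qed
  have "\<exists>l\<in>{0..1}. (d A \<longlongrightarrow> l) F" for A
    using d01 by (intro free_ultrafilter_compact_limit[OF F]) auto
  then obtain \<nu> where \<nu>: "\<And>A. \<nu> A \<in> {0..1}" "\<And>A. (d A \<longlongrightarrow> \<nu> A) F" by metis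
  have "\<nu> A = 1" if "range (\<lambda>n. (T ^^ n) z) \<subseteq> A" for A
  proof -
    have "indicat_real A ((T ^^ i) z) = 1" for i
      using that by (auto simp: indicator_def)
    then have "d A n = 1" if "n > 0" for n
      using that by (simp add: d_def)
    \<comment> \<open>The average at \<open>n = 0\<close> is 0 by the convention for division, so
      only positive \<open>n\<close> count.\<close>
    then have "\<forall>\<^sub>F n in F. d A n = 1"
      using free_ultrafilter_tail[OF F eventually_gt_at_top[of 0]] by (auto elim: eventually_mono)
    then show ?thesis
      using tendsto_unique[OF Fbot \<nu>(2)] tendsto_eventually by blast
  qed
  moreover have "\<nu> (A \<union> B) = \<nu> A + \<nu> B" if "A \<inter> B = {}" for A B
  proof -
    have "indicat_real (A \<union> B) x = indicat_real A x + indicat_real B x" for x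
      using that by (auto simp: indicator_def)
    then have "d (A \<union> B) = (\<lambda>n. d A n + d B n)"
      by (simp add: d_def sum.distrib add_divide_distrib fun_eq_iff)
    then have "(d (A \<union> B) \<longlongrightarrow> \<nu> A + \<nu> B) F"
      using tendsto_add[OF \<nu>(2)[of A] \<nu>(2)[of B]] by simp
    then show ?thesis using tendsto_unique[OF Fbot \<nu>(2)] by blast
  qed
  moreover have "\<nu> (T -` A) = \<nu> A" for A
  proof -
    let ?a = "\<lambda>i. indicat_real A ((T ^^ i) z)"
    \<comment> \<open>The shift changes only the two end terms of the orbit sum, an error of at most
      \<open>1 / n\<close>.\<close>
    have "d (T -` A) n - d A n = (?a n - ?a 0) / n" for n
    proof -
      have "(\<Sum>i<n. ?a (Suc i)) + ?a 0 = (\<Sum>i<n. ?a i) + ?a n"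
        using sum.lessThan_Suc_shift[of ?a n] sum.lessThan_Suc[of ?a n] by linarith
      then show ?thesis
        by (simp add: d_def indicator_vimage diff_divide_distrib[symmetric] del: funpow_0)
    qed
    then have "norm (d (T -` A) n - d A n) \<le> 1 / n" for n
      by (simp add: indicator_def)
    then have "(\<lambda>n. d (T -` A) n - d A n) \<longlonglongrightarrow> 0"
      by (intro Lim_null_comparison[OF _ lim_1_over_n]) auto
    then have "((\<lambda>n. d (T -` A) n - d A n) \<longlongrightarrow> 0) F"
      using F tendsto_mono unfolding free_ultrafilter_def by blast
    moreover have "((\<lambda>n. d (T -` A) n - d A n) \<longlongrightarrow> \<nu> (T -` A) - \<nu> A) F"
      by (intro tendsto_diff \<nu>(2))
    ultimately show ?thesis using tendsto_unique[OF Fbot] by fastforce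
  qed
  ultimately show ?thesis using \<nu>(1) by (intro exI[of _ \<nu>]) auto
qed

section \<open>McMahon's pseudo-metric\<close>

locale minimal_tds_mean = minimal_tds X T
  for X :: "'a::metric_space set" and T :: "'a \<Rightarrow> 'a" +
  fixes \<nu> :: "'a set \<Rightarrow> real"
  assumes mean_nonneg: "0 \<le> \<nu> A"
    and mean_full: "X \<subseteq> A \<Longrightarrow> \<nu> A = 1"
    and mean_disjoint: "A \<inter> B = {} \<Longrightarrow> \<nu> (A \<union> B) = \<nu> A + \<nu> B"
    and mean_vimage: "\<nu> (T -` A) = \<nu> A"
begin

lemma mean_mono: assumes "A \<subseteq> B" shows "\<nu> A \<le> \<nu> B"
proof -
  have "\<nu> B = \<nu> A + \<nu> (B - A)"
    using mean_disjoint[of A "B - A"] assms by (simp add: Un_absorb1)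
  then show ?thesis using mean_nonneg[of "B - A"] by simp
qed

lemma mean_Int_X: "\<nu> (A \<inter> X) = \<nu> A"
proof -
  have "\<nu> UNIV = \<nu> X + \<nu> (- X)"
    using mean_disjoint[of X "- X"] by simp
  then have "\<nu> (- X) = 0" using mean_full[of UNIV] mean_full[of X] by simp
  then have "\<nu> (A - X) = 0"
    using mean_mono[of "A - X" "- X"] mean_nonneg[of "A - X"] by auto
  then show ?thesis
    using mean_disjoint[of "A \<inter> X" "A - X"] by (simp add: Int_Diff_disjoint Int_Diff_Un)
qed

lemma mean_Un_Int: "\<nu> (A \<union> B) + \<nu> (A \<inter> B) = \<nu> A + \<nu> B"
proof -
  have "\<nu> B = \<nu> (A \<inter> B) + \<nu> (B - A)"
  proof -
    have "A \<inter> B \<union> (B - A) = B" "A \<inter> B \<inter> (B - A) = {}" by auto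
    then show ?thesis using mean_disjoint[of "A \<inter> B" "B - A"] by simp
  qed
  moreover have "\<nu> (A \<union> B) = \<nu> A + \<nu> (B - A)"
    using mean_disjoint[of A "B - A"] by simp
  ultimately show ?thesis by simp
qed

lemma mean_vimage_iter: "\<nu> ((T ^^ n) -` A) = \<nu> A"
proof (induction n)
  case (Suc n)
  have "(T ^^ Suc n) -` A = T -` ((T ^^ n) -` A)"
    by (simp only: funpow_Suc_right vimage_comp)
  then show ?case by (simp only: mean_vimage Suc)
qed simp

lemma mean_UN_le: "\<nu> (\<Union>j<N. B j) \<le> (\<Sum>j<N. \<nu> (B j))" for N :: nat
proof (induction N)
  case 0
  show ?case using mean_disjoint[of "{}" "{}"] by simp
next
  case (Suc N)
  have "\<nu> ((\<Union>j<N. B j) \<union> B N) \<le> \<nu> (\<Union>j<N. B j) + \<nu> (B N)"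
    using mean_Un_Int[of "\<Union>j<N. B j" "B N"] mean_nonneg[of "(\<Union>j<N. B j) \<inter> B N"] by simp
  then show ?case using Suc by (simp add: lessThan_Suc Un_commute)
qed

text \<open>By uniform return finitely many preimages of \<open>U\<close> cover \<open>X\<close>;
  all have the mean of \<open>U\<close>, so this mean cannot vanish.\<close>

lemma mean_open_pos:
  assumes "openin (top_of_set X) U" "U \<noteq> {}"
  shows "0 < \<nu> U"
proof -
  obtain N where N: "\<And>x. x \<in> X \<Longrightarrow> \<exists>j<N. (T ^^ j) x \<in> U"
    using uniform_return[OF assms] by blast
  have "X \<subseteq> (\<Union>j<N. (T ^^ j) -` U)" using N by blast
  then have "1 = \<nu> (\<Union>j<N. (T ^^ j) -` U)" by (rule mean_full[symmetric])
  also have "\<dots> \<le> (\<Sum>j<N. \<nu> ((T ^^ j) -` U))" by (rule mean_UN_le)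
  also have "\<dots> = N * \<nu> U" by (simp add: mean_vimage_iter)
  finally show ?thesis using mean_nonneg[of U] by (cases "\<nu> U = 0") auto
qed

section \<open>The outer mean of a set\<close>

definition nbhd :: "real \<Rightarrow> 'a set \<Rightarrow> 'a set" where
  "nbhd \<eta> K = {x. \<exists>k\<in>K. dist x k < \<eta>}"

text \<open>Finite additivity alone gives no continuity; taking the infimum over neighbourhoods makes the
  mean upper semicontinuous, while it stays submodular.\<close>

definition outer :: "'a set \<Rightarrow> real" where
  "outer K = (INF \<eta>\<in>{0<..}. \<nu> (nbhd \<eta> K))"

lemma nbhd_mono: "\<eta> \<le> \<theta> \<Longrightarrow> K \<subseteq> L \<Longrightarrow> nbhd \<eta> K \<subseteq> nbhd \<theta> L"
  unfolding nbhd_def by force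

lemma subset_nbhd: "0 < \<eta> \<Longrightarrow> K \<subseteq> nbhd \<eta> K"
  unfolding nbhd_def by force

lemma nbhd_Un: "nbhd \<eta> (K \<union> L) = nbhd \<eta> K \<union> nbhd \<eta> L"
  unfolding nbhd_def by blast

lemma outer_le: "0 < \<eta> \<Longrightarrow> outer K \<le> \<nu> (nbhd \<eta> K)"
  unfolding outer_def by (intro cINF_lower) (auto intro!: bdd_belowI[of _ 0] mean_nonneg)

lemma le_outer: "(\<And>\<eta>. 0 < \<eta> \<Longrightarrow> c \<le> \<nu> (nbhd \<eta> K)) \<Longrightarrow> c \<le> outer K"
  unfolding outer_def by (intro cINF_greatest) (auto intro: exI[of _ 1])

lemma outer_approx:
  assumes "0 < e" shows "\<exists>\<eta>>0. \<nu> (nbhd \<eta> K) < outer K + e"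
proof (rule ccontr)
  assume "\<not> ?thesis"
  then have "outer K + e \<le> outer K" by (intro le_outer) force
  then show False using assms by simp
qed

lemma outer_mono: "K \<subseteq> L \<Longrightarrow> outer K \<le> outer L"
  by (intro le_outer) (meson outer_le mean_mono nbhd_mono order_refl order_trans)

text \<open>Follows from the modular law of \<open>\<nu>\<close>, because a neighbourhood of
  \<open>P \<inter> Q\<close> lies in the intersection of the neighbourhoods; that inclusion may be
  strict, so only an inequality survives.\<close>

lemma outer_Un_Int: "outer (P \<union> Q) + outer (P \<inter> Q) \<le> outer P + outer Q"
proof (rule field_le_epsilon)
  fix e :: real assume "0 < e"
  then obtain \<eta>1 \<eta>2 where \<eta>: "\<eta>1 > 0" "\<nu> (nbhd \<eta>1 P) < outer P + e/2" "\<eta>2 > 0" "\<nu> (nbhd \<eta>2 Q) < outer Q + e/2"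
    using outer_approx[of "e/2" P] outer_approx[of "e/2" Q] by auto
  define \<eta> where "\<eta> = min \<eta>1 \<eta>2"
  have "\<eta> > 0" using \<eta> by (simp add: \<eta>_def)
  then have "outer (P \<union> Q) + outer (P \<inter> Q) \<le> \<nu> (nbhd \<eta> (P \<union> Q)) + \<nu> (nbhd \<eta> (P \<inter> Q))"
    by (intro add_mono outer_le)
  also have "\<nu> (nbhd \<eta> (P \<inter> Q)) \<le> \<nu> (nbhd \<eta> P \<inter> nbhd \<eta> Q)"
    by (intro mean_mono) (auto simp: nbhd_def)
  also have "\<nu> (nbhd \<eta> (P \<union> Q)) + \<nu> (nbhd \<eta> P \<inter> nbhd \<eta> Q) = \<nu> (nbhd \<eta> P) + \<nu> (nbhd \<eta> Q)"
    unfolding nbhd_Un by (rule mean_Un_Int)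
  also have "\<dots> \<le> \<nu> (nbhd \<eta>1 P) + \<nu> (nbhd \<eta>2 Q)"
    by (intro add_mono mean_mono nbhd_mono) (auto simp: \<eta>_def)
  finally show "outer (P \<union> Q) + outer (P \<inter> Q) \<le> outer P + outer Q + e" using \<eta> by simp
qed

text \<open>Uniform continuity puts a small neighbourhood of \<open>K\<close>, within
  \<open>X\<close>, into the preimage of a given neighbourhood of \<open>L\<close>, and
  \<open>\<nu>\<close> is invariant under preimages.\<close>

lemma outer_le_image:
  assumes "K \<subseteq> X" "L \<subseteq> X" "T ` K \<subseteq> L"
  shows "outer K \<le> outer L"
proof (rule le_outer)
  fix \<eta> :: real assume "0 < \<eta>"
  then obtain \<delta> where \<delta>: "\<delta> > 0" "\<And>x y. x \<in> X \<Longrightarrow> y \<in> X \<Longrightarrow> dist x y < \<delta> \<Longrightarrow> dist (T x) (T y) < \<eta>"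
    using iter_modulus[of \<eta> 1] by auto
  have "nbhd \<delta> K \<inter> X \<subseteq> T -` nbhd \<eta> L"
    using \<delta>(2) assms unfolding nbhd_def by blast
  then have "\<nu> (nbhd \<delta> K) \<le> \<nu> (nbhd \<eta> L)"
    using mean_mono[of "nbhd \<delta> K \<inter> X" "T -` nbhd \<eta> L"] by (simp add: mean_Int_X mean_vimage)
  then show "outer K \<le> \<nu> (nbhd \<eta> L)" using outer_le[OF \<delta>(1), of K] by simp
qed

lemma outer_usc:
  assumes "0 < e" shows "\<exists>\<eta>>0. \<forall>L. L \<subseteq> nbhd \<eta> K \<longrightarrow> outer L < outer K + e"
proof -
  obtain \<eta> where \<eta>: "\<eta> > 0" "\<nu> (nbhd \<eta> K) < outer K + e" using outer_approx[OF assms] by blast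
  have "outer L < outer K + e" if "L \<subseteq> nbhd (\<eta>/2) K" for L
  proof -
    have "nbhd (\<eta>/2) L \<subseteq> nbhd \<eta> K"
    proof
      fix x assume "x \<in> nbhd (\<eta>/2) L"
      then obtain l where l: "l \<in> L" "dist x l < \<eta>/2" unfolding nbhd_def by blast
      then obtain k where k: "k \<in> K" "dist l k < \<eta>/2" using \<open>L \<subseteq> nbhd (\<eta>/2) K\<close> unfolding nbhd_def by blast
      have "dist x k < \<eta>" using l k dist_triangle[of x k l] by simp
      then show "x \<in> nbhd \<eta> K" unfolding nbhd_def using k by blast
    qed
    then show ?thesis using \<eta> outer_le[of "\<eta>/2" L] mean_mono[of "nbhd (\<eta>/2) L" "nbhd \<eta> K"] by simp
  qed
  then show ?thesis using \<eta>(1) by (intro exI[of _ "\<eta>/2"]) auto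
qed

text \<open>A small ball around \<open>w\<close> lies in \<open>L\<close>, has positive mean and
  stays clear of small neighbourhoods of \<open>K\<close>.\<close>

lemma outer_add_ball:
  assumes "w \<in> X" "0 < r" "\<And>k. k \<in> K \<Longrightarrow> r \<le> dist w k" "X \<inter> ball w r \<subseteq> L"
  shows "outer K < outer (K \<union> L)"
proof -
  let ?B = "X \<inter> ball w (r/4)"
  have B: "0 < \<nu> ?B"
    using assms by (intro mean_open_pos openin_open_Int) auto
  have "outer K + \<nu> ?B \<le> outer (K \<union> L)"
  proof (rule le_outer)
    fix \<eta> :: real assume \<eta>: "0 < \<eta>"
    define \<theta> where "\<theta> = min \<eta> (r/4)"
    have \<theta>: "0 < \<theta>" "\<theta> \<le> \<eta>" "\<theta> \<le> r/4" using \<eta> assms(2) by (auto simp: \<theta>_def)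
    have "nbhd \<theta> K \<inter> ?B = {}"
    proof (rule ccontr)
      assume "nbhd \<theta> K \<inter> ?B \<noteq> {}"
      then obtain v k where "k \<in> K" "dist v k < \<theta>" "dist w v < r/4" unfolding nbhd_def by auto
      then show False using assms(2) assms(3)[of k] \<theta> dist_triangle[of w k v] by simp
    qed
    then have "\<nu> (nbhd \<theta> K) + \<nu> ?B = \<nu> (nbhd \<theta> K \<union> ?B)" by (rule mean_disjoint[symmetric])
    also have "\<dots> \<le> \<nu> (nbhd \<eta> (K \<union> L))"
    proof (rule mean_mono)
      have "?B \<subseteq> L" using assms(2,4) by auto
      then have "?B \<subseteq> nbhd \<eta> (K \<union> L)" using subset_nbhd[OF \<eta>, of "K \<union> L"] by blast
      then show "nbhd \<theta> K \<union> ?B \<subseteq> nbhd \<eta> (K \<union> L)" using nbhd_mono[OF \<theta>(2), of K "K \<union> L"] by blast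
    qed
    finally show "outer K + \<nu> ?B \<le> \<nu> (nbhd \<eta> (K \<union> L))" using outer_le[OF \<theta>(1), of K] by simp
  qed
  then show ?thesis using B by simp
qed

end

section \<open>Rows of a closed forward invariant relation\<close>

locale minimal_tds_relation = minimal_tds_mean X T \<nu>
  for X :: "'a::metric_space set" and T :: "'a \<Rightarrow> 'a" and \<nu> :: "'a set \<Rightarrow> real" +
  fixes N :: "('a \<times> 'a) set"
  assumes N_sub: "N \<subseteq> X \<times> X" and N_closed: "closed N"
    and N_invariant: "(a, b) \<in> N \<Longrightarrow> (T a, T b) \<in> N"
begin

lemma row_sub: "N `` {x} \<subseteq> X"
  using N_sub by blast

lemma row_image: "T ` (N `` {x}) \<subseteq> N `` {T x}"
  using N_invariant by blast

text \<open>A closed graph in a compact space: otherwise points \<open>z n\<close> in the rows of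
  points tending to \<open>x\<close> would stay off the neighbourhood, yet accumulate at a point of
  the row of \<open>x\<close>.\<close>

lemma row_usc:
  assumes "x \<in> X" "0 < \<eta>"
  shows "\<exists>\<theta>>0. \<forall>x'\<in>X. dist x x' < \<theta> \<longrightarrow> N `` {x'} \<subseteq> nbhd \<eta> (N `` {x})"
proof (rule ccontr)
  assume neg: "\<not> ?thesis"
  have "\<exists>x' z. dist x x' < inverse (real (Suc n)) \<and> (x', z) \<in> N \<and> z \<notin> nbhd \<eta> (N `` {x})" for n
  proof -
    have "0 < inverse (real (Suc n))" by simp
    then show ?thesis using neg by blast
  qed
  then obtain u z where uz: "\<And>n. dist x (u n) < inverse (real (Suc n))" "\<And>n. (u n, z n) \<in> N"
    "\<And>n. z n \<notin> nbhd \<eta> (N `` {x})" by metis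
  have "compact N"
    using compact_Int_closed[OF compact_Times[OF compact_X compact_X] N_closed] N_sub by (simp add: Int_absorb1)
  then obtain l r where l: "l \<in> N" "strict_mono (r :: nat \<Rightarrow> nat)" "((\<lambda>n. (u n, z n)) \<circ> r) \<longlonglongrightarrow> l"
    using uz(2) compact_imp_seq_compact by (metis (no_types, lifting) seq_compactE)
  obtain a b where ab: "l = (a, b)" by fastforce
  have "u \<longlonglongrightarrow> x"
    by (rule metric_tendsto_imp_tendsto[OF LIMSEQ_inverse_real_of_nat])
      (use uz(1) in \<open>simp add: dist_commute less_imp_le\<close>)
  then have "(u \<circ> r) \<longlonglongrightarrow> x" using l(2) LIMSEQ_subseq_LIMSEQ by blast
  moreover have "(u \<circ> r) \<longlonglongrightarrow> a" "(z \<circ> r) \<longlonglongrightarrow> b"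
    using tendsto_fst[OF l(3)] tendsto_snd[OF l(3)] ab by (simp_all add: o_def)
  ultimately have "a = x" using LIMSEQ_unique by blast
  then have "b \<in> N `` {x}" using l(1) ab by blast
  moreover obtain n where "dist ((z \<circ> r) n) b < \<eta>"
    using \<open>(z \<circ> r) \<longlonglongrightarrow> b\<close> assms(2) metric_LIMSEQ_D by blast
  ultimately show False using uz(3)[of "r n"] unfolding nbhd_def by auto
qed

text \<open>Outer means of rows do not decrease along orbits and are upper semicontinuous; as the
  orbit of \<open>x\<close> comes close to \<open>y\<close>, the value at \<open>x\<close> is at
  most the value at \<open>y\<close>, and the roles can be exchanged.\<close>

lemma outer_row_const:
  assumes "x \<in> X" "y \<in> X"
  shows "outer (N `` {x}) = outer (N `` {y})"
proof -
  have "outer (N `` {x}) \<le> outer (N `` {y})" if "x \<in> X" "y \<in> X" for x y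
  proof (rule field_le_epsilon)
    fix e :: real assume "0 < e"
    then obtain \<eta> where \<eta>: "\<eta> > 0" "\<And>L. L \<subseteq> nbhd \<eta> (N `` {y}) \<Longrightarrow> outer L < outer (N `` {y}) + e"
      using outer_usc by metis
    then obtain \<theta> where \<theta>: "\<theta> > 0" "\<And>x'. x' \<in> X \<Longrightarrow> dist y x' < \<theta> \<Longrightarrow> N `` {x'} \<subseteq> nbhd \<eta> (N `` {y})"
      using row_usc[OF \<open>y \<in> X\<close>] by metis
    obtain n where n: "dist y ((T ^^ n) x) < \<theta>"
      using orbit_approaches[OF \<open>x \<in> X\<close> \<open>y \<in> X\<close> \<theta>(1)] by blast
    have "outer (N `` {x}) \<le> outer (N `` {(T ^^ k) x})" for k
    proof (induction k)
      case (Suc k)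
      have "outer (N `` {(T ^^ k) x}) \<le> outer (N `` {T ((T ^^ k) x)})"
        by (intro outer_le_image row_sub row_image)
      then show ?case using Suc by simp
    qed simp
    from this[of n] show "outer (N `` {x}) \<le> outer (N `` {y}) + e"
      using \<eta>(2)[OF \<theta>(2)[OF iter_in[OF \<open>x \<in> X\<close>] n]] by simp
  qed
  then show ?thesis using assms by (intro antisym) auto
qed

text \<open>Stands in for the measure of the part of the row of \<open>y\<close> outside the row of
  \<open>x\<close>; it is symmetric because all rows have the same outer mean.\<close>

definition \<sigma> :: "'a \<Rightarrow> 'a \<Rightarrow> real" where
  "\<sigma> x y = outer (N `` {x} \<union> N `` {y}) - outer (N `` {x})"

lemma \<sigma>_nonneg: "0 \<le> \<sigma> x y"
  by (simp add: \<sigma>_def outer_mono)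

lemma \<sigma>_sym: "x \<in> X \<Longrightarrow> y \<in> X \<Longrightarrow> \<sigma> x y = \<sigma> y x"
  using outer_row_const[of x y] by (simp add: \<sigma>_def Un_commute)

text \<open>Submodularity for \<open>?A \<union> ?B\<close> and \<open>?B \<union> ?C\<close>, whose
  intersection contains \<open>?B\<close>; the rows \<open>?A\<close> and \<open>?B\<close> have
  equal outer mean.\<close>

lemma \<sigma>_triangle:
  assumes "x \<in> X" "y \<in> X" "z \<in> X"
  shows "\<sigma> x z \<le> \<sigma> x y + \<sigma> y z"
proof -
  let ?A = "N `` {x}" and ?B = "N `` {y}" and ?C = "N `` {z}"
  have "outer (?A \<union> ?C) \<le> outer ((?A \<union> ?B) \<union> (?B \<union> ?C))" "outer ?B \<le> outer ((?A \<union> ?B) \<inter> (?B \<union> ?C))"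
    by (intro outer_mono; blast)+
  then show ?thesis
    using outer_Un_Int[of "?A \<union> ?B" "?B \<union> ?C"] outer_row_const[OF assms(1,2)] by (simp add: \<sigma>_def)
qed

lemma \<sigma>_cont:
  assumes "x \<in> X" "0 < e"
  shows "\<exists>\<theta>>0. \<forall>x'\<in>X. dist x x' < \<theta> \<longrightarrow> \<sigma> x x' < e"
proof -
  obtain \<eta> where \<eta>: "\<eta> > 0" "\<And>L. L \<subseteq> nbhd \<eta> (N `` {x}) \<Longrightarrow> outer L < outer (N `` {x}) + e"
    using outer_usc[OF assms(2)] by metis
  then obtain \<theta> where \<theta>: "\<theta> > 0" "\<And>x'. x' \<in> X \<Longrightarrow> dist x x' < \<theta> \<Longrightarrow> N `` {x'} \<subseteq> nbhd \<eta> (N `` {x})"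
    using row_usc[OF assms(1)] by metis
  have "\<sigma> x x' < e" if "x' \<in> X" "dist x x' < \<theta>" for x'
    using \<eta>(2)[of "N `` {x} \<union> N `` {x'}"] \<theta>(2)[OF that] subset_nbhd[OF \<eta>(1), of "N `` {x}"]
    by (simp add: \<sigma>_def)
  then show ?thesis using \<theta>(1) by blast
qed

lemma \<sigma>_expand:
  assumes "x \<in> X" "y \<in> X"
  shows "\<sigma> x y \<le> \<sigma> (T x) (T y)"
proof -
  have "outer (N `` {x} \<union> N `` {y}) \<le> outer (N `` {T x} \<union> N `` {T y})"
    using row_sub row_image by (intro outer_le_image) blast+
  then show ?thesis
    using outer_row_const[OF assms(1) T_in[OF assms(1)]] by (simp add: \<sigma>_def)
qed

text \<open>Near \<open>w\<close> a ball of the row of \<open>x\<close> lies off the closed row of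
  \<open>y\<close>, so it adds positive mass.\<close>

lemma \<sigma>_pos:
  assumes "x \<in> X" "y \<in> X" "w \<in> X" "0 < r" "\<And>w'. w' \<in> X \<Longrightarrow> dist w w' < r \<Longrightarrow> (x, w') \<in> N" "(y, w) \<notin> N"
  shows "0 < \<sigma> y x"
proof -
  have "\<exists>s>0. \<forall>k\<in>N `` {y}. s \<le> dist w k"
  proof -
    have "closed (N `` {y})"
    proof -
      have "N `` {y} = Pair y -` N" by auto
      moreover have "closed (Pair y -` N)"
        using N_closed by (intro closed_vimage) (auto intro: continuous_intros)
      ultimately show ?thesis by simp
    qed
    then have "open (- (N `` {y}))" by (simp add: open_Compl)
    then obtain s where "s > 0" "ball w s \<subseteq> - (N `` {y})"
      using assms(6) open_contains_ball by (metis ComplI Image_singleton_iff)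
    then show ?thesis by (intro exI[of _ s]) (force simp: not_less[symmetric])
  qed
  then obtain s where s: "s > 0" "\<And>k. k \<in> N `` {y} \<Longrightarrow> s \<le> dist w k" by blast
  have "outer (N `` {y}) < outer (N `` {y} \<union> N `` {x})"
  proof (rule outer_add_ball[OF assms(3)])
    show "0 < min r s" using assms(4) s(1) by simp
    show "min r s \<le> dist w k" if "k \<in> N `` {y}" for k using s(2)[OF that] by simp
    show "X \<inter> ball w (min r s) \<subseteq> N `` {x}" using assms(5) by auto
  qed
  then show ?thesis by (simp add: \<sigma>_def)
qed

end

section \<open>Factoring through the maximal equicontinuous factor\<close>

text \<open>On the compact set where \<open>g\<close> is at least \<open>\<epsilon>\<close>,
  \<open>f\<close> attains a positive minimum, which serves as \<open>\<delta>\<close>.\<close>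

lemma compact_sublevel_modulus:
  fixes f g :: "'a::topological_space \<Rightarrow> real"
  assumes "compact K" "continuous_on K f" "continuous_on K g"
    and "\<And>p. p \<in> K \<Longrightarrow> f p \<le> 0 \<Longrightarrow> g p < \<epsilon>"
  shows "\<exists>\<delta>>0. \<forall>p\<in>K. f p < \<delta> \<longrightarrow> g p < \<epsilon>"
proof -
  let ?L = "{p \<in> K. \<epsilon> \<le> g p}"
  have "compact ?L"
  proof -
    have "closedin (top_of_set K) (K \<inter> g -` {\<epsilon>..})"
      using assms(3) by (intro continuous_closedin_preimage) auto
    moreover have "K \<inter> g -` {\<epsilon>..} = ?L" by auto
    ultimately show ?thesis using closedin_compact[OF assms(1)] by simp
  qed
  show ?thesis
  proof (cases "?L = {}")
    case True
    then show ?thesis by (intro exI[of _ 1]) force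
  next
    case False
    obtain q where q: "q \<in> ?L" "\<And>p. p \<in> ?L \<Longrightarrow> f q \<le> f p"
      using continuous_attains_inf[OF \<open>compact ?L\<close> False continuous_on_subset[OF assms(2)]] by blast
    then have "0 < f q" using assms(4)[of q] by force
    moreover have "g p < \<epsilon>" if "p \<in> K" "f p < f q" for p
      using q(2)[of p] that by force
    ultimately show ?thesis by blast
  qed
qed

section \<open>Invariance of the pseudo-metric and its equicontinuous quotient\<close>

context minimal_tds_relation
begin

lemma \<sigma>_expand_iter:
  assumes "x \<in> X" "y \<in> X"
  shows "\<sigma> x y \<le> \<sigma> ((T ^^ n) x) ((T ^^ n) y)"
proof (induction n)
  case (Suc n)
  then show ?case using \<sigma>_expand[OF iter_in[OF assms(1)] iter_in[OF assms(2)], of n n] by simp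
qed simp

text \<open>The orbit of \<open>(x, y)\<close> in the compact square comes close to itself at two
  times \<open>i < j\<close>; as \<open>\<sigma>\<close> expands, this closeness already holds
  between the times \<open>0\<close> and \<open>j - i\<close>.\<close>

lemma \<sigma>_recurrence:
  assumes "x \<in> X" "y \<in> X" "0 < e"
  shows "\<exists>k\<ge>1. \<sigma> x ((T ^^ k) x) < e \<and> \<sigma> y ((T ^^ k) y) < e"
proof -
  let ?f = "\<lambda>n. ((T ^^ n) x, (T ^^ n) y)"
  have "?f n \<in> X \<times> X" for n using assms iter_in by simp
  then obtain l r where l: "l \<in> X \<times> X" "strict_mono (r :: nat \<Rightarrow> nat)" "(?f \<circ> r) \<longlonglongrightarrow> l"
    using compact_imp_seq_compact[OF compact_Times[OF compact_X compact_X]] by (metis (no_types, lifting) seq_compactE)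
  obtain p q where pq: "l = (p, q)" "p \<in> X" "q \<in> X" using l(1) by blast
  obtain \<theta>1 \<theta>2 where \<theta>: "\<theta>1 > 0" "\<And>x'. x' \<in> X \<Longrightarrow> dist p x' < \<theta>1 \<Longrightarrow> \<sigma> p x' < e/2"
      "\<theta>2 > 0" "\<And>x'. x' \<in> X \<Longrightarrow> dist q x' < \<theta>2 \<Longrightarrow> \<sigma> q x' < e/2"
    using \<sigma>_cont[OF pq(2), of "e/2"] \<sigma>_cont[OF pq(3), of "e/2"] assms(3) by (metis half_gt_zero)
  have "(\<lambda>n. (T ^^ r n) x) \<longlonglongrightarrow> p" "(\<lambda>n. (T ^^ r n) y) \<longlonglongrightarrow> q"
    using tendsto_fst[OF l(3)] tendsto_snd[OF l(3)] pq(1) by (simp_all add: o_def)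
  then have "\<forall>\<^sub>F n in sequentially. dist ((T ^^ r n) x) p < \<theta>1 \<and> dist ((T ^^ r n) y) q < \<theta>2"
    using \<theta>(1,3) by (simp add: tendsto_iff eventually_conj)
  then obtain n where n: "\<And>m. m \<ge> n \<Longrightarrow> dist ((T ^^ r m) x) p < \<theta>1 \<and> dist ((T ^^ r m) y) q < \<theta>2"
    unfolding eventually_sequentially by blast
  define i j where "i = r n" and "j = r (Suc n)"
  have ij: "i < j" using l(2) by (simp add: i_def j_def strict_mono_Suc_iff)
  have near: "\<sigma> p ((T ^^ i) x) < e/2" "\<sigma> p ((T ^^ j) x) < e/2" "\<sigma> q ((T ^^ i) y) < e/2" "\<sigma> q ((T ^^ j) y) < e/2"
    using n[of n] n[of "Suc n"] \<theta>(2,4) iter_in assms by (simp_all add: i_def j_def dist_commute)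
  have step: "\<sigma> z ((T ^^ (j - i)) z) < e" if "z \<in> X" "c \<in> X" "\<sigma> c ((T ^^ i) z) < e/2" "\<sigma> c ((T ^^ j) z) < e/2" for z c
  proof -
    have "(T ^^ i) ((T ^^ (j - i)) z) = (T ^^ j) z"
      using ij by (metis comp_apply funpow_add le_add_diff_inverse less_imp_le)
    then have "\<sigma> z ((T ^^ (j - i)) z) \<le> \<sigma> ((T ^^ i) z) ((T ^^ j) z)"
      using \<sigma>_expand_iter[OF that(1) iter_in[OF that(1)], of "j - i" i] by simp
    also have "\<dots> \<le> \<sigma> ((T ^^ i) z) c + \<sigma> c ((T ^^ j) z)"
      by (intro \<sigma>_triangle iter_in that)
    also have "\<dots> < e"
      using that(3,4) \<sigma>_sym[OF that(2) iter_in[OF that(1)], of i] by simp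
    finally show ?thesis .
  qed
  show ?thesis
    using step[OF assms(1) pq(2) near(1,2)] step[OF assms(2) pq(3) near(3,4)] ij
    by (intro exI[of _ "j - i"]) auto
qed

text \<open>An expanding pseudo-metric on a compact space is isometric, because two points return
  simultaneously arbitrarily close to themselves.\<close>

lemma \<sigma>_isometric:
  assumes "x \<in> X" "y \<in> X"
  shows "\<sigma> (T x) (T y) = \<sigma> x y"
proof (rule antisym)
  show "\<sigma> (T x) (T y) \<le> \<sigma> x y"
  proof (rule field_le_epsilon)
    fix e :: real assume "0 < e"
    then obtain k where k: "k \<ge> 1" "\<sigma> x ((T ^^ k) x) < e/2" "\<sigma> y ((T ^^ k) y) < e/2"
      using \<sigma>_recurrence[OF assms, of "e/2"] by auto
    obtain m where m: "k = Suc m" using k(1) by (cases k) auto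
    \<comment> \<open>Expansion carries \<open>T x\<close> and \<open>T y\<close> on to time
      \<open>k\<close>, when both points are \<open>\<sigma>\<close>-close to \<open>x\<close> and
      \<open>y\<close> again.\<close>
    have "\<sigma> (T x) (T y) \<le> \<sigma> ((T ^^ k) x) ((T ^^ k) y)"
      using \<sigma>_expand_iter[OF T_in[OF assms(1)] T_in[OF assms(2)], of m]
      by (simp add: m funpow_swap1)
    also have "\<dots> \<le> \<sigma> ((T ^^ k) x) x + \<sigma> x ((T ^^ k) y)"
      by (intro \<sigma>_triangle iter_in assms)
    also have "\<dots> \<le> \<sigma> ((T ^^ k) x) x + (\<sigma> x y + \<sigma> y ((T ^^ k) y))"
      by (intro add_left_mono \<sigma>_triangle iter_in assms)
    finally show "\<sigma> (T x) (T y) \<le> \<sigma> x y + e"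
      using k \<sigma>_sym[OF assms(1) iter_in[OF assms(1)], of k] by simp
  qed
qed (rule \<sigma>_expand[OF assms])

lemma \<sigma>_isometric_iter:
  assumes "x \<in> X" "y \<in> X"
  shows "\<sigma> ((T ^^ n) x) ((T ^^ n) y) = \<sigma> x y"
  using assms by (induction n) (simp_all add: \<sigma>_isometric iter_in)

lemma \<sigma>_continuous: "continuous_on (X \<times> X) (\<lambda>p. \<sigma> (fst p) (snd p))"
  unfolding continuous_on_iff
proof (intro ballI allI impI)
  fix p :: "'a \<times> 'a" and e :: real assume p: "p \<in> X \<times> X" and "0 < e"
  then have ab: "fst p \<in> X" "snd p \<in> X" by auto
  obtain \<theta>1 \<theta>2 where \<theta>: "\<theta>1 > 0" "\<And>x'. x' \<in> X \<Longrightarrow> dist (fst p) x' < \<theta>1 \<Longrightarrow> \<sigma> (fst p) x' < e/2"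
      "\<theta>2 > 0" "\<And>x'. x' \<in> X \<Longrightarrow> dist (snd p) x' < \<theta>2 \<Longrightarrow> \<sigma> (snd p) x' < e/2"
    using \<sigma>_cont[OF ab(1), of "e/2"] \<sigma>_cont[OF ab(2), of "e/2"] \<open>0 < e\<close> by (metis half_gt_zero)
  have "dist (\<sigma> (fst q) (snd q)) (\<sigma> (fst p) (snd p)) < e"
    if q: "q \<in> X \<times> X" and d: "dist q p < min \<theta>1 \<theta>2" for q
  proof -
    have cd: "fst q \<in> X" "snd q \<in> X" using q by auto
    have "dist (fst q) (fst p) < \<theta>1" "dist (snd q) (snd p) < \<theta>2"
      using d dist_fst_le[of q p] dist_snd_le[of q p] by simp_all
    then have "\<sigma> (fst p) (fst q) < e/2" "\<sigma> (snd p) (snd q) < e/2"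
      using \<theta> cd by (simp_all add: dist_commute)
    moreover have "\<sigma> (fst q) (snd q) \<le> \<sigma> (fst p) (fst q) + \<sigma> (fst p) (snd p) + \<sigma> (snd p) (snd q)"
      using \<sigma>_triangle[OF cd(1) ab(1) cd(2)] \<sigma>_triangle[OF ab cd(2)] \<sigma>_sym[OF ab(1) cd(1)] by simp
    moreover have "\<sigma> (fst p) (snd p) \<le> \<sigma> (fst p) (fst q) + \<sigma> (fst q) (snd q) + \<sigma> (snd p) (snd q)"
      using \<sigma>_triangle[OF ab(1) cd(1) ab(2)] \<sigma>_triangle[OF cd ab(2)] \<sigma>_sym[OF ab(2) cd(2)] by simp
    ultimately show ?thesis by (simp add: dist_real_def)
  qed
  then show "\<exists>d>0. \<forall>q\<in>X \<times> X. dist q p < d \<longrightarrow> dist (\<sigma> (fst q) (snd q)) (\<sigma> (fst p) (snd p)) < e"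
    using \<theta>(1,3) by (intro exI[of _ "min \<theta>1 \<theta>2"]) auto
qed

text \<open>Values of \<open>\<sigma>\<close> at a dense sequence serve as coordinates, so that the
  quotient sits in the type \<open>nat \<Rightarrow> real\<close> over which
  \<open>max_eq_factor\<close> tests maximality.\<close>

lemma \<sigma>_factor:
  "\<exists>(Z :: (nat \<Rightarrow> real) set) R \<phi>. factor_map X T Z R \<phi> \<and> equicontinuous_sys Z R \<and>
     (\<forall>x\<in>X. \<forall>y\<in>X. \<phi> x = \<phi> y \<longrightarrow> \<sigma> x y = 0)"
proof -
  obtain s where s: "range s \<subseteq> X" "\<And>x \<epsilon>. x \<in> X \<Longrightarrow> 0 < \<epsilon> \<Longrightarrow> \<exists>n::nat. dist x (s n) < \<epsilon>"
    using dense_sequence by blast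
  have sX: "s n \<in> X" for n using s(1) by blast
  define \<phi> where "\<phi> x = (\<lambda>n. \<sigma> x (s n))" for x
  have \<phi>_eq: "\<sigma> x y = 0" if "x \<in> X" "y \<in> X" "\<phi> x = \<phi> y" for x y
  proof (rule ccontr)
    assume "\<sigma> x y \<noteq> 0"
    then have "0 < \<sigma> x y / 2" using \<sigma>_nonneg[of x y] by simp
    then obtain \<theta> where \<theta>: "\<theta> > 0" "\<And>x'. x' \<in> X \<Longrightarrow> dist y x' < \<theta> \<Longrightarrow> \<sigma> y x' < \<sigma> x y / 2"
      using \<sigma>_cont[OF \<open>y \<in> X\<close>] by metis
    then obtain n where "\<sigma> y (s n) < \<sigma> x y / 2" using s(2)[OF \<open>y \<in> X\<close>] sX by blast
    moreover have "\<sigma> x (s n) = \<sigma> y (s n)" using that(3) by (simp add: \<phi>_def fun_eq_iff)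
    ultimately show False
      using \<sigma>_triangle[OF that(1) sX[of n] that(2)] \<sigma>_sym[OF that(2) sX[of n]] by simp
  qed
  have \<phi>_zero: "\<phi> x = \<phi> y" if "x \<in> X" "y \<in> X" "\<sigma> x y = 0" for x y
  proof
    fix n
    show "\<phi> x n = \<phi> y n"
      using \<sigma>_triangle[OF that(1,2) sX[of n]] \<sigma>_triangle[OF that(2,1) sX[of n]] \<sigma>_sym[OF that(1,2)] that(3)
      by (simp add: \<phi>_def)
  qed
  have \<phi>_cont: "continuous_on X \<phi>"
  proof (rule continuous_on_coordinatewise_then_product)
    fix n
    have "continuous_on X (\<lambda>x. (x, s n))" by (intro continuous_intros)
    from continuous_on_compose2[OF \<sigma>_continuous this] show "continuous_on X (\<lambda>x. \<phi> x n)"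
      using sX by (auto simp: \<phi>_def)
  qed
  have \<phi>2_cont: "continuous_on (X \<times> X) (\<lambda>p. dist (\<phi> (fst p)) (\<phi> (snd p)))"
    by (intro continuous_on_dist continuous_on_compose2[OF \<phi>_cont] continuous_intros) auto
  have compact_XX: "compact (X \<times> X)" by (intro compact_Times compact_X)
  \<comment> \<open>\<open>inv_into\<close> picks one point of each class; by invariance of
    \<open>\<sigma>\<close> the choice does not affect the result.\<close>
  define R where "R w = \<phi> (T (inv_into X \<phi> w))" for w
  have R: "R (\<phi> x) = \<phi> (T x)" if "x \<in> X" for x
  proof -
    let ?y = "inv_into X \<phi> (\<phi> x)"
    have y: "?y \<in> X" "\<phi> ?y = \<phi> x"
      using that by (auto intro: inv_into_into f_inv_into_f)
    then have "\<sigma> (T ?y) (T x) = 0" using \<phi>_eq[OF y(1) that] \<sigma>_isometric[OF y(1) that] by simp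
    then show ?thesis unfolding R_def using \<phi>_zero[OF T_in[OF y(1)] T_in[OF that]] by simp
  qed
  have Rn: "(R ^^ n) (\<phi> x) = \<phi> ((T ^^ n) x)" if "x \<in> X" for x n
    using that by (induction n) (simp_all add: R iter_in)
  \<comment> \<open>The product metric and \<open>\<sigma>\<close> vanish on the same pairs of the
    compact square, hence control each other uniformly, and \<open>\<sigma>\<close> does not change
    under \<open>T\<close>.\<close>
  have equi: "equicontinuous_sys (\<phi> ` X) R"
    unfolding equicontinuous_sys_def
  proof (intro allI impI)
    fix \<epsilon> :: real assume "0 < \<epsilon>"
    then have "\<exists>\<eta>>0. \<forall>p\<in>X \<times> X. \<sigma> (fst p) (snd p) < \<eta> \<longrightarrow> dist (\<phi> (fst p)) (\<phi> (snd p)) < \<epsilon>"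
    proof (intro compact_sublevel_modulus[OF compact_XX \<sigma>_continuous \<phi>2_cont])
      fix p assume p: "p \<in> X \<times> X" "\<sigma> (fst p) (snd p) \<le> 0"
      then have "\<phi> (fst p) = \<phi> (snd p)"
        using \<sigma>_nonneg[of "fst p" "snd p"] by (intro \<phi>_zero) auto
      then show "dist (\<phi> (fst p)) (\<phi> (snd p)) < \<epsilon>" using \<open>0 < \<epsilon>\<close> by simp
    qed
    then obtain \<eta> where \<eta>: "\<eta> > 0" "\<And>x y. x \<in> X \<Longrightarrow> y \<in> X \<Longrightarrow> \<sigma> x y < \<eta> \<Longrightarrow> dist (\<phi> x) (\<phi> y) < \<epsilon>"
      by auto
    have "\<exists>\<delta>>0. \<forall>p\<in>X \<times> X. dist (\<phi> (fst p)) (\<phi> (snd p)) < \<delta> \<longrightarrow> \<sigma> (fst p) (snd p) < \<eta>"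
    proof (intro compact_sublevel_modulus[OF compact_XX \<phi>2_cont \<sigma>_continuous])
      fix p assume p: "p \<in> X \<times> X" "dist (\<phi> (fst p)) (\<phi> (snd p)) \<le> 0"
      then have "\<sigma> (fst p) (snd p) = 0" by (intro \<phi>_eq) auto
      then show "\<sigma> (fst p) (snd p) < \<eta>" using \<eta>(1) by simp
    qed
    then obtain \<delta> where \<delta>: "\<delta> > 0" "\<And>x y. x \<in> X \<Longrightarrow> y \<in> X \<Longrightarrow> dist (\<phi> x) (\<phi> y) < \<delta> \<Longrightarrow> \<sigma> x y < \<eta>"
      by auto
    have "dist ((R ^^ n) (\<phi> x)) ((R ^^ n) (\<phi> y)) < \<epsilon>" if "x \<in> X" "y \<in> X" "dist (\<phi> x) (\<phi> y) < \<delta>" for x y n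
      using \<eta>(2)[OF iter_in[OF that(1), of n] iter_in[OF that(2), of n]] \<delta>(2)[OF that] that
      by (simp add: Rn \<sigma>_isometric_iter)
    then show "\<exists>\<delta>>0. \<forall>x\<in>\<phi> ` X. \<forall>y\<in>\<phi> ` X. dist x y < \<delta> \<longrightarrow> (\<forall>n. dist ((R ^^ n) x) ((R ^^ n) y) < \<epsilon>)"
      using \<delta>(1) by auto
  qed
  have "continuous_on (\<phi> ` X) R"
    unfolding continuous_on_iff
  proof (intro ballI allI impI)
    fix w and e :: real assume w: "w \<in> \<phi> ` X" "0 < e"
    then obtain \<delta> where "\<delta> > 0" and \<delta>: "\<forall>x\<in>\<phi> ` X. \<forall>y\<in>\<phi> ` X. dist x y < \<delta> \<longrightarrow> (\<forall>n. dist ((R ^^ n) x) ((R ^^ n) y) < e)"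
      using equi unfolding equicontinuous_sys_def by blast
    have "dist (R w') (R w) < e" if "w' \<in> \<phi> ` X" "dist w' w < \<delta>" for w'
      using \<delta>[rule_format, OF that(1) w(1) that(2), of 1] by simp
    then show "\<exists>d>0. \<forall>w'\<in>\<phi> ` X. dist w' w < d \<longrightarrow> dist (R w') (R w) < e"
      using \<open>\<delta> > 0\<close> by blast
  qed
  moreover have "R ` \<phi> ` X = \<phi> ` X"
  proof -
    have "R ` \<phi> ` X = \<phi> ` T ` X" using R by (simp add: image_image)
    then show ?thesis by (simp add: T_image)
  qed
  ultimately have "tds (\<phi> ` X) R"
    using compact_continuous_image[OF \<phi>_cont compact_X] X_nonempty by (simp add: tds_def)
  then have "factor_map X T (\<phi> ` X) R \<phi>"
    unfolding factor_map_def using tds \<phi>_cont R by simp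
  then show ?thesis using equi \<phi>_eq by blast
qed

end

section \<open>Rows over one fibre of the maximal equicontinuous factor\<close>

locale minimal_max_eq_factor = minimal_tds X T
  for X :: "'a::metric_space set" and T :: "'a \<Rightarrow> 'a" +
  fixes Y :: "'b::metric_space set" and S :: "'b \<Rightarrow> 'b" and \<pi> :: "'a \<Rightarrow> 'b"
  assumes max_eq: "max_eq_factor X T Y S \<pi>"
begin

text \<open>If \<open>(y, w)\<close> were missing, \<open>\<sigma> y x\<close> would be positive;
  but \<open>\<pi>\<close> factors the quotient by \<open>\<sigma>\<close>, so
  \<open>\<pi> x = \<pi> y\<close> forces it to vanish. A whole ball in the row of \<open>x\<close>
  is assumed because nonempty open sets are what is known to have positive mean.\<close>

lemma fibre_rows:
  assumes N: "N \<subseteq> X \<times> X" "closed N" "\<And>a b. (a, b) \<in> N \<Longrightarrow> (T a, T b) \<in> N"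
    and xy: "x \<in> X" "y \<in> X" "\<pi> x = \<pi> y"
    and w: "w \<in> X" "0 < r" "\<And>w'. w' \<in> X \<Longrightarrow> dist w w' < r \<Longrightarrow> (x, w') \<in> N"
  shows "(y, w) \<in> N"
proof (rule ccontr)
  assume "(y, w) \<notin> N"
  have orbit: "range (\<lambda>n. (T ^^ n) x) \<subseteq> X" using iter_in[OF xy(1)] by blast
  obtain \<nu> :: "'a set \<Rightarrow> real" where \<nu>: "\<forall>A. 0 \<le> \<nu> A"
      "\<forall>A. range (\<lambda>n. (T ^^ n) x) \<subseteq> A \<longrightarrow> \<nu> A = 1"
      "\<forall>A B. A \<inter> B = {} \<longrightarrow> \<nu> (A \<union> B) = \<nu> A + \<nu> B" "\<forall>A. \<nu> (T -` A) = \<nu> A"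
    using invariant_mean_exists[of T x] by blast
  interpret minimal_tds_relation X T \<nu> N
  proof unfold_locales
    show "\<nu> A = 1" if "X \<subseteq> A" for A using \<nu>(2) orbit that by (meson subset_trans)
    show "N \<subseteq> X \<times> X" "closed N" by (rule N(1), rule N(2))
  qed (use \<nu>(1,3,4) N(3) in auto)
  obtain Z :: "(nat \<Rightarrow> real) set" and R \<phi> where \<phi>: "factor_map X T Z R \<phi>" "equicontinuous_sys Z R"
      "\<forall>x\<in>X. \<forall>y\<in>X. \<phi> x = \<phi> y \<longrightarrow> \<sigma> x y = 0"
    using \<sigma>_factor by blast
  then obtain \<psi> where "\<forall>x\<in>X. \<phi> x = \<psi> (\<pi> x)"
    using max_eq unfolding max_eq_factor_def by blast
  then have "\<sigma> y x = 0" using \<phi>(3) xy by simp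
  moreover have "0 < \<sigma> y x"
    using \<sigma>_pos[OF xy(1,2) w] \<open>(y, w) \<notin> N\<close> by blast
  ultimately show False by simp
qed

end

section \<open>Fibres and regional proximality\<close>

text \<open>\<open>f\<close> may fail to be injective, so \<open>inv_into\<close> fixes one preimage
  at each step; \<open>k\<close> steps forward undo \<open>k\<close> of these choices.\<close>

lemma backward_orbit:
  assumes "f ` A = A" "y \<in> A"
  shows "(inv_into A f ^^ n) y \<in> A" "(f ^^ k) ((inv_into A f ^^ (k + n)) y) = (inv_into A f ^^ n) y"
proof -
  show mem: "(inv_into A f ^^ n) y \<in> A" for n
    by (induction n) (use assms in \<open>auto intro: inv_into_into\<close>)
  show "(f ^^ k) ((inv_into A f ^^ (k + n)) y) = (inv_into A f ^^ n) y"
  proof (induction k)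
    case (Suc k)
    have "f ((inv_into A f ^^ (Suc k + n)) y) = (inv_into A f ^^ (k + n)) y"
      using mem[of "k + n"] assms(1) by (simp add: f_inv_into_f)
    then show ?case using Suc by (simp only: funpow_Suc_right comp_apply)
  qed simp
qed

section \<open>Recurrence and injectivity on the equicontinuous factor\<close>

context minimal_max_eq_factor
begin

lemma compact_Y: "compact Y" and S_image: "S ` Y = Y"
  and \<pi>_cont: "continuous_on X \<pi>" and \<pi>_image: "\<pi> ` X = Y"
  and \<pi>_T: "x \<in> X \<Longrightarrow> \<pi> (T x) = S (\<pi> x)" and equi: "equicontinuous_sys Y S"
  using max_eq by (auto simp: max_eq_factor_def factor_map_def tds_def)

lemma \<pi>_in: "x \<in> X \<Longrightarrow> \<pi> x \<in> Y"
  using \<pi>_image by blast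

lemma \<pi>_iter: "x \<in> X \<Longrightarrow> \<pi> ((T ^^ n) x) = (S ^^ n) (\<pi> x)"
  by (induction n) (simp_all add: \<pi>_T iter_in)

lemma S_iter_in: "y \<in> Y \<Longrightarrow> (S ^^ n) y \<in> Y"
  by (induction n) (use S_image in auto)

lemma equi_modulus:
  assumes "0 < \<epsilon>"
  obtains \<delta> where "0 < \<delta>" "\<And>u v n. u \<in> Y \<Longrightarrow> v \<in> Y \<Longrightarrow> dist u v < \<delta> \<Longrightarrow> dist ((S ^^ n) u) ((S ^^ n) v) < \<epsilon>"
  using equi assms unfolding equicontinuous_sys_def by metis

text \<open>Backward orbits of \<open>u\<close> and \<open>v\<close> come close to themselves
  simultaneously at depths \<open>a\<close> and \<open>k + a\<close>; pushing forward
  \<open>k + a\<close> steps turns this into a return at time \<open>k\<close>, controlled by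
  equicontinuity.\<close>

lemma Y_recurrence:
  assumes "u \<in> Y" "v \<in> Y" "0 < \<epsilon>"
  shows "\<exists>k\<ge>n. dist ((S ^^ k) u) u < \<epsilon> \<and> dist ((S ^^ k) v) v < \<epsilon>"
proof -
  obtain \<delta> where \<delta>: "0 < \<delta>" "\<And>u v n. u \<in> Y \<Longrightarrow> v \<in> Y \<Longrightarrow> dist u v < \<delta> \<Longrightarrow> dist ((S ^^ n) u) ((S ^^ n) v) < \<epsilon>"
    using equi_modulus[OF assms(3)] by blast
  let ?g = "inv_into Y S"
  have mem: "(?g ^^ i) u \<in> Y" "(?g ^^ i) v \<in> Y" for i
    using backward_orbit(1)[OF S_image] assms by auto
  \<comment> \<open>Only depths divisible by \<open>Suc n\<close> are used, which makes the
    difference \<open>k\<close> at least \<open>n\<close>.\<close>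
  obtain i j where ij: "i < j"
    "dist ((?g ^^ (i * Suc n)) u, (?g ^^ (i * Suc n)) v) ((?g ^^ (j * Suc n)) u, (?g ^^ (j * Suc n)) v) < \<delta>"
    using compact_close_pair[OF compact_Times[OF compact_Y compact_Y], of "\<lambda>i. ((?g ^^ (i * Suc n)) u, (?g ^^ (i * Suc n)) v)" \<delta>]
      mem \<delta>(1) by auto
  define a k where "a = i * Suc n" and "k = (j - i) * Suc n"
  have b: "j * Suc n = k + a" using ij(1) by (simp add: a_def k_def add_mult_distrib[symmetric])
  have "1 * n \<le> (j - i) * Suc n" using ij(1) by (intro mult_le_mono) auto
  then have "n \<le> k" by (simp add: k_def)
  have close: "dist ((S ^^ k) z) z < \<epsilon>" if z: "z \<in> Y" and d: "dist ((?g ^^ a) z) ((?g ^^ (k + a)) z) < \<delta>" for z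
  proof -
    have "dist ((S ^^ (k + a)) ((?g ^^ a) z)) ((S ^^ (k + a)) ((?g ^^ (k + a)) z)) < \<epsilon>"
      by (rule \<delta>(2)[OF backward_orbit(1)[OF S_image z] backward_orbit(1)[OF S_image z] d])
    moreover have "(S ^^ (k + a)) ((?g ^^ (k + a)) z) = z"
      using backward_orbit(2)[OF S_image z, of "k + a" 0] by simp
    moreover have "(S ^^ (k + a)) ((?g ^^ a) z) = (S ^^ k) z"
      using backward_orbit(2)[OF S_image z, of a 0] by (simp add: funpow_add)
    ultimately show ?thesis by simp
  qed
  have "dist ((?g ^^ a) u) ((?g ^^ (k + a)) u) < \<delta>" "dist ((?g ^^ a) v) ((?g ^^ (k + a)) v) < \<delta>"
    using ij(2) dist_fst_le[of "((?g ^^ a) u, (?g ^^ a) v)" "((?g ^^ (k + a)) u, (?g ^^ (k + a)) v)"]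
      dist_snd_le[of "((?g ^^ a) u, (?g ^^ a) v)" "((?g ^^ (k + a)) u, (?g ^^ (k + a)) v)"]
    unfolding a_def[symmetric] b by simp_all
  then show ?thesis using close assms \<open>n \<le> k\<close> by blast
qed

text \<open>Points close at time \<open>n\<close> stay close until a common return time
  \<open>k \<ge> n\<close>, when both are back near their starting positions.\<close>

lemma inverse_equi_modulus:
  assumes "0 < \<epsilon>"
  obtains \<delta> where "0 < \<delta>" "\<And>u v n. u \<in> Y \<Longrightarrow> v \<in> Y \<Longrightarrow> dist ((S ^^ n) u) ((S ^^ n) v) < \<delta> \<Longrightarrow> dist u v < \<epsilon>"
proof -
  have e3: "0 < \<epsilon>/3" using assms by simp
  obtain \<delta> where \<delta>: "0 < \<delta>" "\<And>u v n. u \<in> Y \<Longrightarrow> v \<in> Y \<Longrightarrow> dist u v < \<delta> \<Longrightarrow> dist ((S ^^ n) u) ((S ^^ n) v) < \<epsilon>/3"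
    using equi_modulus[OF e3] by blast
  have "dist u v < \<epsilon>" if uv: "u \<in> Y" "v \<in> Y" and d: "dist ((S ^^ n) u) ((S ^^ n) v) < \<delta>" for u v n
  proof -
    obtain k where k: "k \<ge> n" "dist ((S ^^ k) u) u < \<epsilon>/3" "dist ((S ^^ k) v) v < \<epsilon>/3"
      using Y_recurrence[OF uv e3] by blast
    have "dist ((S ^^ (k - n)) ((S ^^ n) u)) ((S ^^ (k - n)) ((S ^^ n) v)) < \<epsilon>/3"
      using \<delta>(2) d S_iter_in uv by blast
    moreover have "(S ^^ (k - n)) ((S ^^ n) z) = (S ^^ k) z" for z
      using k(1) by (metis comp_apply funpow_add le_add_diff_inverse2)
    ultimately have "dist ((S ^^ k) u) ((S ^^ k) v) < \<epsilon>/3" by simp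
    then show ?thesis
      using k(2,3) dist_triangle[of u v "(S ^^ k) u"] dist_triangle[of "(S ^^ k) u" v "(S ^^ k) v"]
      by (simp add: dist_commute)
  qed
  then show thesis using that \<delta>(1) by blast
qed

lemma S_iter_inj:
  assumes "u \<in> Y" "v \<in> Y" "(S ^^ n) u = (S ^^ n) v"
  shows "u = v"
proof (rule ccontr)
  assume "u \<noteq> v"
  then have "0 < dist u v" by simp
  from inverse_equi_modulus[OF this] obtain \<delta> where "0 < \<delta>"
    "\<And>a b n. a \<in> Y \<Longrightarrow> b \<in> Y \<Longrightarrow> dist ((S ^^ n) a) ((S ^^ n) b) < \<delta> \<Longrightarrow> dist a b < dist u v" by blast
  from this(2)[OF assms(1,2), of n] show False using assms(3) \<open>0 < \<delta>\<close> by simp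
qed

lemma \<pi>_modulus:
  assumes "0 < \<epsilon>"
  obtains \<delta> where "0 < \<delta>" "\<And>a b. a \<in> X \<Longrightarrow> b \<in> X \<Longrightarrow> dist a b < \<delta> \<Longrightarrow> dist (\<pi> a) (\<pi> b) < \<epsilon>"
  using compact_uniformly_continuous[OF \<pi>_cont compact_X] assms
  unfolding uniformly_continuous_on_def by metis

text \<open>Points that some \<open>T^n\<close> brings together have images in \<open>Y\<close> that
  were close from the start, by \<open>inverse_equi_modulus\<close>; so \<open>\<pi> x\<close> and
  \<open>\<pi> y\<close> cannot be apart.\<close>

lemma regionally_proximal_imp_fibre:
  assumes "regionally_proximal X T x y"
  shows "\<pi> x = \<pi> y"
proof (rule ccontr)
  assume "\<pi> x \<noteq> \<pi> y"
  define e where "e = dist (\<pi> x) (\<pi> y) / 3"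
  have "0 < e" using \<open>\<pi> x \<noteq> \<pi> y\<close> by (simp add: e_def)
  have xy: "x \<in> X" "y \<in> X" using assms by (auto simp: regionally_proximal_def)
  obtain \<delta> where \<delta>: "0 < \<delta>" "\<And>u v n. u \<in> Y \<Longrightarrow> v \<in> Y \<Longrightarrow> dist ((S ^^ n) u) ((S ^^ n) v) < \<delta> \<Longrightarrow> dist u v < e"
    using inverse_equi_modulus[OF \<open>0 < e\<close>] by blast
  obtain \<eta> where \<eta>: "0 < \<eta>" "\<And>a b. a \<in> X \<Longrightarrow> b \<in> X \<Longrightarrow> dist a b < \<eta> \<Longrightarrow> dist (\<pi> a) (\<pi> b) < \<delta>"
    using \<pi>_modulus[OF \<delta>(1)] by blast
  obtain \<theta> where \<theta>: "0 < \<theta>" "\<And>a b. a \<in> X \<Longrightarrow> b \<in> X \<Longrightarrow> dist a b < \<theta> \<Longrightarrow> dist (\<pi> a) (\<pi> b) < e"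
    using \<pi>_modulus[OF \<open>0 < e\<close>] by blast
  have "openin (top_of_set X) (X \<inter> ball x \<theta>)" "openin (top_of_set X) (X \<inter> ball y \<theta>)"
    "x \<in> X \<inter> ball x \<theta>" "y \<in> X \<inter> ball y \<theta>"
    using xy \<theta>(1) by (auto simp: openin_open_Int)
  then obtain a b n where ab: "a \<in> X \<inter> ball x \<theta>" "b \<in> X \<inter> ball y \<theta>" "dist ((T ^^ n) a) ((T ^^ n) b) < \<eta>"
    using assms \<eta>(1) unfolding regionally_proximal_def by metis
  have "dist ((S ^^ n) (\<pi> a)) ((S ^^ n) (\<pi> b)) < \<delta>"
    using \<eta>(2)[OF _ _ ab(3)] ab(1,2) iter_in by (simp add: \<pi>_iter)
  then have "dist (\<pi> a) (\<pi> b) < e" using \<delta>(2) ab(1,2) \<pi>_in by blast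
  moreover have "dist (\<pi> x) (\<pi> a) < e" "dist (\<pi> y) (\<pi> b) < e"
    using \<theta>(2) ab(1,2) xy by auto
  ultimately have "dist (\<pi> x) (\<pi> y) < e + e + e"
    using dist_triangle[of "\<pi> x" "\<pi> y" "\<pi> a"] dist_triangle[of "\<pi> a" "\<pi> y" "\<pi> b"]
    by (simp add: dist_commute)
  then show False by (simp add: e_def)
qed

text \<open>Otherwise \<open>fibre_rows\<close> applies to the relation \<open>N\<close> of pairs
  that stay \<open>\<epsilon>\<close> apart from time 1 on: a ball around \<open>y\<close> lies in
  the row of \<open>x\<close>, so \<open>(y, y)\<close> would lie in \<open>N\<close>.\<close>

lemma fibre_imp_regionally_proximal:
  assumes xy: "x \<in> X" "y \<in> X" "\<pi> x = \<pi> y"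
  shows "regionally_proximal X T x y"
proof (rule ccontr)
  assume "\<not> ?thesis"
  then obtain \<epsilon> U1 U2 where \<epsilon>: "\<epsilon> > 0" and U: "x \<in> U1" "openin (top_of_set X) U2" "y \<in> U2"
    and far: "\<And>a b n. a \<in> U1 \<Longrightarrow> b \<in> U2 \<Longrightarrow> 1 \<le> n \<Longrightarrow> \<epsilon> \<le> dist ((T ^^ n) a) ((T ^^ n) b)"
    using xy(1,2) unfolding regionally_proximal_def by (meson not_le)
  define N where "N = {p \<in> X \<times> X. \<forall>n\<ge>1. \<epsilon> \<le> dist ((T ^^ n) (fst p)) ((T ^^ n) (snd p))}"
  have "closed N"
  proof -
    have XX: "compact (X \<times> X)" by (intro compact_Times compact_X)
    have "closed {p \<in> X \<times> X. \<epsilon> \<le> dist ((T ^^ n) (fst p)) ((T ^^ n) (snd p))}" for n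
    proof -
      have "continuous_on (X \<times> X) (\<lambda>p. dist ((T ^^ n) (fst p)) ((T ^^ n) (snd p)))"
        by (intro continuous_on_dist continuous_on_compose2[OF iter_cont] continuous_intros) auto
      from continuous_closed_preimage[OF this compact_imp_closed[OF XX], of "{\<epsilon>..}"]
      show ?thesis by (simp add: vimage_def Collect_conj_eq[symmetric] Int_def)
    qed
    moreover have "N = (X \<times> X) \<inter> (\<Inter>n\<in>{1..}. {p \<in> X \<times> X. \<epsilon> \<le> dist ((T ^^ n) (fst p)) ((T ^^ n) (snd p))})"
      by (auto simp: N_def)
    ultimately show ?thesis using compact_imp_closed[OF XX] by auto
  qed
  moreover have "(T a, T b) \<in> N" if "(a, b) \<in> N" for a b
  proof -
    have "\<epsilon> \<le> dist ((T ^^ n) (T a)) ((T ^^ n) (T b))" for n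
    proof -
      have "\<epsilon> \<le> dist ((T ^^ Suc n) a) ((T ^^ Suc n) b)"
        using that unfolding N_def by (auto dest: spec[of _ "Suc n"])
      then show ?thesis by (simp add: funpow_swap1)
    qed
    then show ?thesis using that T_in by (simp add: N_def)
  qed
  moreover obtain r where r: "r > 0" "X \<inter> ball y r \<subseteq> U2"
    using U(2,3) by (metis openin_contains_ball inf_commute)
  have "(x, w') \<in> N" if "w' \<in> X" "dist y w' < r" for w'
    using far[OF U(1)] r(2) that xy(1) by (auto simp: N_def)
  ultimately have "(y, y) \<in> N"
    using fibre_rows[of N x y y r] xy r(1) unfolding N_def by blast
  then show False using \<epsilon> by (auto simp: N_def)
qed

text \<open>Regional proximality backwards in time.\<close>

lemma fibre_from_close_pairs:
  assumes xy: "x \<in> X" "y \<in> X" "\<pi> x = \<pi> y" and "0 < \<rho>" "0 < \<eta>"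
  shows "\<exists>a\<in>X. \<exists>b\<in>X. \<exists>n. dist a b < \<rho> \<and> dist ((T ^^ n) a) x < \<eta> \<and> dist ((T ^^ n) b) y < \<eta>"
proof -
  \<comment> \<open>The forward orbit of the \<open>\<rho>\<close>-neighbourhood of the diagonal;
    its closure is the relation fed to \<open>fibre_rows\<close>.\<close>
  define N0 where "N0 = {((T ^^ n) a, (T ^^ n) b) | n a b. a \<in> X \<and> b \<in> X \<and> dist a b < \<rho>}"
  have N0_sub: "N0 \<subseteq> X \<times> X" using iter_in unfolding N0_def by auto
  have closed_XX: "closed (X \<times> X)"
    by (intro compact_imp_closed compact_Times compact_X)
  have "(T u, T v) \<in> closure N0" if uv: "(u, v) \<in> closure N0" for u v
  proof -
    have sub: "closure N0 \<subseteq> X \<times> X" by (rule closure_minimal[OF N0_sub closed_XX])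
    obtain f where f: "\<And>n. f n \<in> N0" "f \<longlonglongrightarrow> (u, v)"
      using uv unfolding closure_sequential by blast
    have fX: "fst (f n) \<in> X" "snd (f n) \<in> X" for n
      using subsetD[OF N0_sub f(1)[of n]] by (auto simp: mem_Times_iff)
    have uvX: "u \<in> X" "v \<in> X" using subsetD[OF sub uv] by auto
    have "(\<lambda>n. T (fst (f n))) \<longlonglongrightarrow> T u" "(\<lambda>n. T (snd (f n))) \<longlonglongrightarrow> T v"
      using iter_tendsto[of "\<lambda>n. fst (f n)" u sequentially 1] iter_tendsto[of "\<lambda>n. snd (f n)" v sequentially 1]
        tendsto_fst[OF f(2)] tendsto_snd[OF f(2)] fX uvX by simp_all
    then have "(\<lambda>n. (T (fst (f n)), T (snd (f n)))) \<longlonglongrightarrow> (T u, T v)" by (rule tendsto_Pair)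
    moreover have "(T (fst (f n)), T (snd (f n))) \<in> N0" for n
    proof -
      obtain m a b where "f n = ((T ^^ m) a, (T ^^ m) b)" "a \<in> X" "b \<in> X" "dist a b < \<rho>"
        using f(1)[of n] unfolding N0_def by blast
      then show ?thesis unfolding N0_def by (intro CollectI exI[of _ "Suc m"] exI[of _ a] exI[of _ b]) simp
    qed
    ultimately show ?thesis
      unfolding closure_sequential by (intro exI[of _ "\<lambda>n. (T (fst (f n)), T (snd (f n)))"] conjI allI)
  qed
  \<comment> \<open>Time 0 puts the whole \<open>\<rho>\<close>-ball around \<open>x\<close> into
    the row of \<open>x\<close>, so the relation reaches \<open>(y, x)\<close>; the two coordinates
    are exchanged at the end.\<close>
  moreover have "(x, w') \<in> closure N0" if "w' \<in> X" "dist x w' < \<rho>" for w'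
  proof -
    have "(x, w') \<in> N0"
      unfolding N0_def using that xy(1) by (intro CollectI exI[of _ 0] exI[of _ x] exI[of _ w']) simp
    then show ?thesis using closure_subset by blast
  qed
  ultimately have "(y, x) \<in> closure N0"
    using fibre_rows[of "closure N0" x y x \<rho>] xy \<open>0 < \<rho>\<close> closure_minimal[OF N0_sub closed_XX] by blast
  then obtain p where p: "p \<in> N0" "dist p (y, x) < \<eta>"
    using closure_approachable \<open>0 < \<eta>\<close> by blast
  then obtain n a b where ab: "p = ((T ^^ n) a, (T ^^ n) b)" "a \<in> X" "b \<in> X" "dist a b < \<rho>"
    unfolding N0_def by blast
  have "dist ((T ^^ n) a) y < \<eta>" "dist ((T ^^ n) b) x < \<eta>"
    using p(2) dist_fst_le[of p "(y, x)"] dist_snd_le[of p "(y, x)"] ab(1) by simp_all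
  then show ?thesis using ab by (metis dist_commute)
qed

text \<open>The sum of the two distances to \<open>\<pi> x\<close> vanishes only on pairs of the
  fibre, where distances are below \<open>\<epsilon>\<close>; compactness extends the bound to
  nearby fibres.\<close>

lemma fibre_modulus:
  assumes "x \<in> X" "0 < \<epsilon>" "\<And>p q. p \<in> X \<Longrightarrow> q \<in> X \<Longrightarrow> \<pi> p = \<pi> x \<Longrightarrow> \<pi> q = \<pi> x \<Longrightarrow> dist p q < \<epsilon>"
  obtains r where "0 < r" "\<And>p q. p \<in> X \<Longrightarrow> q \<in> X \<Longrightarrow> dist (\<pi> p) (\<pi> x) < r \<Longrightarrow> dist (\<pi> q) (\<pi> x) < r \<Longrightarrow> dist p q < \<epsilon>"
proof -
  have "\<exists>\<delta>>0. \<forall>p\<in>X \<times> X. dist (\<pi> (fst p)) (\<pi> x) + dist (\<pi> (snd p)) (\<pi> x) < \<delta> \<longrightarrow> dist (fst p) (snd p) < \<epsilon>"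
  proof (intro compact_sublevel_modulus compact_Times compact_X)
    show "continuous_on (X \<times> X) (\<lambda>p. dist (\<pi> (fst p)) (\<pi> x) + dist (\<pi> (snd p)) (\<pi> x))"
      by (intro continuous_on_add continuous_on_dist continuous_on_compose2[OF \<pi>_cont] continuous_intros) auto
    show "continuous_on (X \<times> X) (\<lambda>p. dist (fst p) (snd p))"
      by (intro continuous_intros)
    fix p assume p: "p \<in> X \<times> X" "dist (\<pi> (fst p)) (\<pi> x) + dist (\<pi> (snd p)) (\<pi> x) \<le> 0"
    have "dist (\<pi> (fst p)) (\<pi> x) = 0" "dist (\<pi> (snd p)) (\<pi> x) = 0"
      using p(2) zero_le_dist[of "\<pi> (fst p)" "\<pi> x"] zero_le_dist[of "\<pi> (snd p)" "\<pi> x"] by linarith+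
    then show "dist (fst p) (snd p) < \<epsilon>" using assms(3) p(1) by auto
  qed
  then obtain \<delta> where \<delta>: "\<delta> > 0"
    "\<And>p q. p \<in> X \<Longrightarrow> q \<in> X \<Longrightarrow> dist (\<pi> p) (\<pi> x) + dist (\<pi> q) (\<pi> x) < \<delta> \<Longrightarrow> dist p q < \<epsilon>" by auto
  show thesis
  proof (rule that[of "\<delta>/2"])
    show "dist p q < \<epsilon>" if "p \<in> X" "q \<in> X" "dist (\<pi> p) (\<pi> x) < \<delta>/2" "dist (\<pi> q) (\<pi> x) < \<delta>/2" for p q
      using \<delta>(2)[OF that(1,2)] that(3,4) by simp
  qed (use \<delta>(1) in simp)
qed

text \<open>When \<open>S^n\<close> returns close to \<open>\<pi> x\<close>, \<open>T^n\<close> maps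
  \<open>U\<close> close to the one-point fibre, hence to a small set. A pigeonhole on the orbit of
  \<open>\<pi> x\<close> at the times in \<open>E\<close> finds such a return time in
  \<open>Delta E\<close>.\<close>

lemma singleton_fibre_not_fDelta_sensitive:
  assumes x: "x \<in> X" "{x' \<in> X. \<pi> x' = \<pi> x} = {x}"
  shows "\<not> F_sensitive X T fDelta_family"
proof
  assume "F_sensitive X T fDelta_family"
  then obtain \<delta> where "\<delta> > 0"
    and sens: "\<And>U. openin (top_of_set X) U \<Longrightarrow> U \<noteq> {} \<Longrightarrow> fDelta_family (Nset T \<delta> U)"
    unfolding F_sensitive_def by blast
  have "dist p q < \<delta>" if "p \<in> X" "q \<in> X" "\<pi> p = \<pi> x" "\<pi> q = \<pi> x" for p q
    using x(2) that \<open>\<delta> > 0\<close> by (metis (mono_tags, lifting) dist_self mem_Collect_eq singletonD)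
  from fibre_modulus[OF x(1) \<open>\<delta> > 0\<close> this]
  obtain r where r: "0 < r" "\<And>p q. p \<in> X \<Longrightarrow> q \<in> X \<Longrightarrow> dist (\<pi> p) (\<pi> x) < r \<Longrightarrow> dist (\<pi> q) (\<pi> x) < r \<Longrightarrow> dist p q < \<delta>"
    by blast
  \<comment> \<open>One half of \<open>r\<close> is for the spread of \<open>U\<close> in the
    factor, the other for the inexact return of \<open>\<pi> x\<close>.\<close>
  have r2: "0 < r/2" using r(1) by simp
  obtain \<delta>1 where \<delta>1: "0 < \<delta>1" "\<And>u v n. u \<in> Y \<Longrightarrow> v \<in> Y \<Longrightarrow> dist u v < \<delta>1 \<Longrightarrow> dist ((S ^^ n) u) ((S ^^ n) v) < r/2"
    using equi_modulus[OF r2] by blast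
  obtain \<delta>2 where \<delta>2: "0 < \<delta>2" "\<And>u v n. u \<in> Y \<Longrightarrow> v \<in> Y \<Longrightarrow> dist ((S ^^ n) u) ((S ^^ n) v) < \<delta>2 \<Longrightarrow> dist u v < r/2"
    using inverse_equi_modulus[OF r2] by blast
  define U where "U = X \<inter> \<pi> -` ball (\<pi> x) \<delta>1"
  have "openin (top_of_set X) U" "U \<noteq> {}"
    unfolding U_def using continuous_openin_preimage_gen[OF \<pi>_cont open_ball] x(1) \<delta>1(1) by auto
  then have fD: "fDelta_family (Nset T \<delta> U)" by (rule sens)
  have small: "n \<notin> Nset T \<delta> U" if n: "dist ((S ^^ n) (\<pi> x)) (\<pi> x) < r/2" for n
  proof -
    have near: "dist (\<pi> ((T ^^ n) p)) (\<pi> x) < r" if "p \<in> U" for p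
    proof -
      have p: "p \<in> X" "dist (\<pi> p) (\<pi> x) < \<delta>1" using that by (auto simp: U_def dist_commute)
      have "dist ((S ^^ n) (\<pi> p)) ((S ^^ n) (\<pi> x)) < r/2"
        using \<delta>1(2) p \<pi>_in x(1) by blast
      then show ?thesis
        using n dist_triangle[of "(S ^^ n) (\<pi> p)" "\<pi> x" "(S ^^ n) (\<pi> x)"] by (simp add: \<pi>_iter[OF p(1)])
    qed
    have "diameter ((T ^^ n) ` U) \<le> \<delta>"
    proof (rule diameter_le_dist)
      fix a b assume "a \<in> (T ^^ n) ` U" "b \<in> (T ^^ n) ` U"
      then obtain p q where "a = (T ^^ n) p" "b = (T ^^ n) q" "p \<in> U" "q \<in> U" by blast
      then show "dist a b \<le> \<delta>"
        using r(2)[of a b] near iter_in by (auto simp: U_def less_imp_le)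
    qed (use \<open>\<delta> > 0\<close> in simp)
    then show ?thesis by (simp add: Nset_def)
  qed
  have "Y \<subseteq> (\<Union>c\<in>Y. ball c (\<delta>2/2))" using \<delta>2(1) by auto
  then obtain C where C: "finite C" "Y \<subseteq> (\<Union>c\<in>C. ball c (\<delta>2/2))"
    by (rule compactE_image[OF compact_Y open_ball])
  \<comment> \<open>One more time than there are balls in the finite cover, so two times share a
    ball.\<close>
  obtain E where E: "finite E" "Suc (card C) \<le> card E" "Delta E \<subseteq> Nset T \<delta> U"
    using fD unfolding fDelta_family_def by blast
  have "\<forall>e\<in>E. \<exists>c\<in>C. dist c ((S ^^ e) (\<pi> x)) < \<delta>2/2"
  proof
    fix e assume "e \<in> E"
    have "(S ^^ e) (\<pi> x) \<in> (\<Union>c\<in>C. ball c (\<delta>2/2))"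
      using C(2) S_iter_in[OF \<pi>_in[OF x(1)]] by blast
    then show "\<exists>c\<in>C. dist c ((S ^^ e) (\<pi> x)) < \<delta>2/2" by simp
  qed
  then obtain c where c: "\<And>e. e \<in> E \<Longrightarrow> c e \<in> C \<and> dist (c e) ((S ^^ e) (\<pi> x)) < \<delta>2/2" by metis
  have "\<not> inj_on c E"
  proof
    assume "inj_on c E"
    then have "card E \<le> card C" using card_inj_on_le[of c E C] c C(1) by blast
    then show False using E(2) by simp
  qed
  then obtain a b where ab: "a \<in> E" "b \<in> E" "c a = c b" "b < a"
    unfolding inj_on_def by (metis linorder_neqE_nat)
  have "dist ((S ^^ a) (\<pi> x)) ((S ^^ b) (\<pi> x)) < \<delta>2"
    using c[OF ab(1)] c[OF ab(2)] ab(3) dist_triangle[of "(S ^^ a) (\<pi> x)" "(S ^^ b) (\<pi> x)" "c a"]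
    by (simp add: dist_commute)
  moreover have "(S ^^ a) (\<pi> x) = (S ^^ b) ((S ^^ (a - b)) (\<pi> x))"
    using ab(4) by (metis comp_apply funpow_add le_add_diff_inverse less_imp_le)
  ultimately have "dist ((S ^^ (a - b)) (\<pi> x)) (\<pi> x) < r/2"
    using \<delta>2(2)[of "(S ^^ (a - b)) (\<pi> x)" "\<pi> x" b] S_iter_in \<pi>_in[OF x(1)] by simp
  then have "a - b \<notin> Nset T \<delta> U" by (rule small)
  moreover have "a - b \<in> Delta E" using ab unfolding Delta_def by blast
  ultimately show False using E(3) by blast
qed

text \<open>As \<open>S^n\<close> is injective on \<open>Y\<close>, every preimage of
  \<open>p\<close> under \<open>T^n\<close> lies in the fibre of \<open>x\<close>: iterates map
  fibres onto fibres.\<close>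

lemma fibre_lift:
  assumes "x \<in> X" "p \<in> X" "\<pi> p = \<pi> ((T ^^ n) x)"
  shows "\<exists>q\<in>X. \<pi> q = \<pi> x \<and> (T ^^ n) q = p"
proof -
  have "p \<in> (T ^^ n) ` X" using assms(2) by (simp add: iter_image)
  then obtain q where q: "q \<in> X" "(T ^^ n) q = p" by blast
  then have "(S ^^ n) (\<pi> q) = (S ^^ n) (\<pi> x)"
    using assms(3) \<pi>_iter[OF q(1), of n] \<pi>_iter[OF assms(1), of n] by simp
  then have "\<pi> q = \<pi> x" by (rule S_iter_inj[OF \<pi>_in[OF q(1)] \<pi>_in[OF assms(1)]])
  then show ?thesis using q by blast
qed

text \<open>The points whose fibre has diameter below a given bound form an open set; by minimality it is
  dense as soon as such sets are nonempty for all bounds, and Baire's theorem applies.\<close>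

lemma not_almost_one_to_one_imp_large_fibres:
  assumes "\<not> almost_one_to_one X \<pi>"
  shows "\<exists>\<delta>>0. \<forall>x\<in>X. \<exists>y\<in>X. \<pi> x = \<pi> y \<and> \<delta> < dist x y"
proof (rule ccontr)
  assume neg: "\<not> ?thesis"
  define G where "G \<epsilon> = {x \<in> X. \<forall>p\<in>X. \<forall>q\<in>X. \<pi> p = \<pi> x \<longrightarrow> \<pi> q = \<pi> x \<longrightarrow> dist p q < \<epsilon>}" for \<epsilon> :: real
  have G_nonempty: "G \<epsilon> \<noteq> {}" if "0 < \<epsilon>" for \<epsilon>
  proof -
    have "0 < \<epsilon>/3" using that by simp
    then obtain x where x: "x \<in> X" "\<And>y. y \<in> X \<Longrightarrow> \<pi> x = \<pi> y \<Longrightarrow> dist x y \<le> \<epsilon>/3"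
      using neg by (meson not_le)
    have "dist p q < \<epsilon>" if "p \<in> X" "q \<in> X" "\<pi> p = \<pi> x" "\<pi> q = \<pi> x" for p q
      using x(2)[of p] x(2)[of q] that dist_triangle[of p q x] \<open>0 < \<epsilon>\<close> by (simp add: dist_commute)
    then show ?thesis using x(1) unfolding G_def by blast
  qed
  have G_open: "openin (top_of_set X) (G \<epsilon>)" if "0 < \<epsilon>" for \<epsilon>
  proof -
    have "\<exists>e>0. \<forall>x'\<in>X. dist x' x < e \<longrightarrow> x' \<in> G \<epsilon>" if "x \<in> G \<epsilon>" for x
    proof -
      have x: "x \<in> X" using that by (simp add: G_def)
      have "\<And>p q. p \<in> X \<Longrightarrow> q \<in> X \<Longrightarrow> \<pi> p = \<pi> x \<Longrightarrow> \<pi> q = \<pi> x \<Longrightarrow> dist p q < \<epsilon>"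
        using that by (simp add: G_def)
      from fibre_modulus[OF x \<open>0 < \<epsilon>\<close> this]
      obtain r where r: "0 < r" "\<And>p q. p \<in> X \<Longrightarrow> q \<in> X \<Longrightarrow> dist (\<pi> p) (\<pi> x) < r \<Longrightarrow> dist (\<pi> q) (\<pi> x) < r \<Longrightarrow> dist p q < \<epsilon>"
        by blast
      obtain e where e: "0 < e" "\<And>a b. a \<in> X \<Longrightarrow> b \<in> X \<Longrightarrow> dist a b < e \<Longrightarrow> dist (\<pi> a) (\<pi> b) < r"
        using \<pi>_modulus[OF r(1)] by blast
      have "x' \<in> G \<epsilon>" if "x' \<in> X" "dist x' x < e" for x'
        using r(2) e(2)[OF that(1) x that(2)] that(1) by (simp add: G_def)
      then show ?thesis using e(1) by blast
    qed
    then show ?thesis unfolding openin_euclidean_subtopology_iff by (auto simp: G_def)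
  qed
  have G_dense: "(top_of_set X) closure_of (G \<epsilon>) = topspace (top_of_set X)" if "0 < \<epsilon>" for \<epsilon>
  proof (rule dense_intersects_open[THEN iffD2], intro allI impI)
    fix U assume U: "openin (top_of_set X) U \<and> U \<noteq> {}"
    obtain N where N: "\<And>x. x \<in> X \<Longrightarrow> \<exists>j<N. (T ^^ j) x \<in> U"
      using uniform_return[OF conjunct1[OF U] conjunct2[OF U]] by blast
    \<comment> \<open>A fibre with distances below \<open>\<delta>\<close> keeps them below
      \<open>\<epsilon>\<close> for \<open>N\<close> steps, and by \<open>fibre_lift\<close> its
      images are whole fibres.\<close>
    obtain \<delta> where \<delta>: "\<delta> > 0" "\<And>k x y. k \<le> N \<Longrightarrow> x \<in> X \<Longrightarrow> y \<in> X \<Longrightarrow> dist x y < \<delta> \<Longrightarrow> dist ((T ^^ k) x) ((T ^^ k) y) < \<epsilon>"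
      using iter_modulus[OF \<open>0 < \<epsilon>\<close>] by metis
    obtain x where x: "x \<in> G \<delta>" using G_nonempty[OF \<delta>(1)] by blast
    then have xX: "x \<in> X" by (simp add: G_def)
    obtain j where j: "j < N" "(T ^^ j) x \<in> U" using N[OF xX] by blast
    have "dist p q < \<epsilon>" if pq: "p \<in> X" "q \<in> X" "\<pi> p = \<pi> ((T ^^ j) x)" "\<pi> q = \<pi> ((T ^^ j) x)" for p q
    proof -
      obtain p' q' where "p' \<in> X" "\<pi> p' = \<pi> x" "(T ^^ j) p' = p" "q' \<in> X" "\<pi> q' = \<pi> x" "(T ^^ j) q' = q"
        using fibre_lift[OF xX] pq by blast
      then show ?thesis using \<delta>(2)[of j p' q'] x j(1) by (simp add: G_def)
    qed
    then have "(T ^^ j) x \<in> G \<epsilon>" using iter_in[OF xX] by (simp add: G_def)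
    then show "G \<epsilon> \<inter> U \<noteq> {}" using j(2) by blast
  qed
  let ?\<G> = "range (\<lambda>n. G (inverse (real (Suc n))))"
  have "(top_of_set X) closure_of \<Inter>?\<G> = topspace (top_of_set X)"
  proof (rule Baire_category)
    have "locally_compact_space (top_of_set X)"
      using compact_X by (intro compact_imp_locally_compact_space) (simp add: compact_space_subtopology)
    moreover have "regular_space (top_of_set X)"
      by (intro metrizable_imp_regular_space metrizable_space_subtopology metrizable_space_euclidean)
    ultimately show "completely_metrizable_space (top_of_set X) \<or>
        locally_compact_space (top_of_set X) \<and> regular_space (top_of_set X)" by blast
  qed (use G_open G_dense in auto)
  then have "X \<subseteq> closure (\<Inter>?\<G>)"
    using closure_mono[OF Int_lower2, of X "\<Inter>?\<G>"] by (auto simp: closure_of_subtopology)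
  also have "\<Inter>?\<G> \<subseteq> {x \<in> X. {x' \<in> X. \<pi> x' = \<pi> x} = {x}}"
  proof
    fix x assume "x \<in> \<Inter>?\<G>"
    then have x: "x \<in> G (inverse (real (Suc n)))" for n by blast
    then have xX: "x \<in> X" by (simp add: G_def)
    have "x' = x" if "x' \<in> X" "\<pi> x' = \<pi> x" for x'
    proof (rule ccontr)
      assume "x' \<noteq> x"
      then obtain n where "inverse (real (Suc n)) < dist x' x"
        using reals_Archimedean[of "dist x' x"] by auto
      then show False using x[of n] that xX by (force simp: G_def)
    qed
    then show "x \<in> {x \<in> X. {x' \<in> X. \<pi> x' = \<pi> x} = {x}}" using xX by blast
  qed
  then have "closure (\<Inter>?\<G>) \<subseteq> closure {x \<in> X. {x' \<in> X. \<pi> x' = \<pi> x} = {x}}" by (rule closure_mono)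
  finally show False using assms unfolding almost_one_to_one_def by simp
qed

end

section \<open>Sensitivity\<close>

context minimal_tds
begin

text \<open>If thick syndeticity fails on \<open>U\<close>, there are longer and longer windows starting at \<open>m K\<close> in which
  the images of \<open>U\<close> are small along a syndetic pattern. An ultrafilter limit \<open>A\<close> of the sets
  \<open>T^(m K) U\<close> stays small along a syndetic set, and since finitely many images of \<open>A\<close> cover \<open>X\<close>,
  one of them has interior, on which sensitivity is not thick.\<close>

lemma thick_sensitive_imp_thickly_syndetic:
  assumes sens: "\<And>U. openin (top_of_set X) U \<Longrightarrow> U \<noteq> {} \<Longrightarrow> thick (Nset T \<delta> U)" and "0 < \<delta>"
    and U: "openin (top_of_set X) U" "U \<noteq> {}"
  shows "thickly_syndetic (Nset T \<delta> U)"
proof (rule ccontr)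
  assume "\<not> ?thesis"
  then obtain S Th where S: "syndetic S" and Th: "thick Th" and disj: "Nset T \<delta> U \<inter> (S \<inter> Th) = {}"
    unfolding thickly_syndetic_def piecewise_syndetic_def by blast
  obtain L where L: "\<And>m. \<exists>k\<in>S. m \<le> k \<and> k < m + L" using S unfolding syndetic_def by blast
  obtain m where m: "\<And>K. {m K..<m K + K} \<subseteq> Th" using Th unfolding thick_def by metis
  obtain F where F: "free_ultrafilter F" using free_ultrafilter_exists by blast
  then have Fbot: "F \<noteq> bot" by (simp add: free_ultrafilter_def)
  have UX: "U \<subseteq> X" using U(1) by (rule openin_imp_subset)
  define A where "A = {x \<in> X. \<forall>\<epsilon>>0. \<forall>\<^sub>F K in F. \<exists>u\<in>U. dist ((T ^^ m K) u) x < \<epsilon>}"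
  have AX: "A \<subseteq> X" by (auto simp: A_def)
  have "closed A"
  proof -
    have "x \<in> A" if "x \<in> closure A" for x
    proof -
      have "closure A \<subseteq> X" using AX compact_imp_closed[OF compact_X] by (rule closure_minimal)
      moreover have "\<forall>\<^sub>F K in F. \<exists>u\<in>U. dist ((T ^^ m K) u) x < \<epsilon>" if "0 < \<epsilon>" for \<epsilon>
      proof -
        obtain y where y: "y \<in> A" "dist y x < \<epsilon>/2"
          using \<open>x \<in> closure A\<close> \<open>0 < \<epsilon>\<close> closure_approachable by (metis half_gt_zero)
        have "0 < \<epsilon>/2" using \<open>0 < \<epsilon>\<close> by simp
        then have "\<forall>\<^sub>F K in F. \<exists>u\<in>U. dist ((T ^^ m K) u) y < \<epsilon>/2" using y(1) unfolding A_def by blast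
        then show ?thesis
        proof (rule eventually_mono)
          fix K assume "\<exists>u\<in>U. dist ((T ^^ m K) u) y < \<epsilon>/2"
          then obtain u where u: "u \<in> U" "dist ((T ^^ m K) u) y < \<epsilon>/2" by blast
          have "dist ((T ^^ m K) u) x < \<epsilon>" using u(2) y(2) dist_triangle[of "(T ^^ m K) u" x y] by simp
          then show "\<exists>u\<in>U. dist ((T ^^ m K) u) x < \<epsilon>" using u(1) by blast
        qed
      qed
      ultimately show ?thesis using that by (auto simp: A_def)
    qed
    then show ?thesis using closure_subset_eq by blast
  qed
  have closed_image: "closedin (top_of_set X) ((T ^^ i) ` A)" for i
  proof (rule closed_subset)
    show "(T ^^ i) ` A \<subseteq> X" using image_mono[OF AX, of "T ^^ i"] by (simp add: iter_image)
    have "compact A" using compact_Int_closed[OF compact_X \<open>closed A\<close>] AX by (simp add: Int_absorb1)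
    then show "closed ((T ^^ i) ` A)"
      using compact_continuous_image[OF continuous_on_subset[OF iter_cont AX]] compact_imp_closed by blast
  qed
  obtain N where N: "\<And>x. x \<in> X \<Longrightarrow> \<exists>j<N. (T ^^ j) x \<in> U" using uniform_return[OF U] by blast
  have cover: "X \<subseteq> (\<Union>i\<in>{1..N}. (T ^^ i) ` A)"
  proof
    fix x assume x: "x \<in> X"
    \<comment> \<open>Go back \<open>m K + N\<close> steps from \<open>x\<close> and wait
      \<open>j < N\<close> steps for \<open>U\<close>: after \<open>T^(m K)\<close> there remain
      \<open>i = N - j\<close> steps. That \<open>i\<close> is positive gives the positivity of the
      time \<open>n\<close> below.\<close>
    have "\<exists>i\<in>{1..N}. \<exists>u\<in>U. (T ^^ i) ((T ^^ m K) u) = x" for K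
    proof -
      have "x \<in> (T ^^ (m K + N)) ` X" using x by (simp add: iter_image)
      then obtain v where v: "v \<in> X" "(T ^^ (m K + N)) v = x" by blast
      obtain j where j: "j < N" "(T ^^ j) v \<in> U" using N[OF v(1)] by blast
      have "(T ^^ (N - j)) ((T ^^ m K) ((T ^^ j) v)) = (T ^^ (N - j + m K + j)) v"
        by (simp add: funpow_add)
      also have "N - j + m K + j = m K + N" using j(1) by simp
      finally show ?thesis using v(2) j by (intro bexI[of _ "N - j"] bexI[of _ "(T ^^ j) v"]) auto
    qed
    then have "\<exists>i\<in>{1..N}. \<forall>\<^sub>F K in F. \<exists>u\<in>U. (T ^^ i) ((T ^^ m K) u) = x"
      by (intro free_ultrafilter_disj_finite[OF F]) auto
    then obtain i where i: "i \<in> {1..N}" "\<forall>\<^sub>F K in F. \<exists>u\<in>U. (T ^^ i) ((T ^^ m K) u) = x" by blast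
    \<comment> \<open>For the remaining \<open>K\<close> any point of \<open>U\<close> serves as
      \<open>u K\<close>, since \<open>F\<close> ignores them.\<close>
    have "\<exists>u\<in>U. (\<exists>u\<in>U. (T ^^ i) ((T ^^ m K) u) = x) \<longrightarrow> (T ^^ i) ((T ^^ m K) u) = x" for K
      using U(2) by blast
    then obtain u where u: "\<And>K. u K \<in> U"
      "\<And>K. (\<exists>u\<in>U. (T ^^ i) ((T ^^ m K) u) = x) \<Longrightarrow> (T ^^ i) ((T ^^ m K) (u K)) = x" by metis
    have inX: "(T ^^ m K) (u K) \<in> X" for K by (rule iter_in[OF subsetD[OF UX u(1)]])
    obtain a where a: "a \<in> X" "((\<lambda>K. (T ^^ m K) (u K)) \<longlongrightarrow> a) F"
      using free_ultrafilter_compact_limit[OF F compact_X, of "\<lambda>K. (T ^^ m K) (u K)"] inX by auto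
    have "\<forall>\<^sub>F K in F. \<exists>u\<in>U. dist ((T ^^ m K) u) a < \<epsilon>" if "0 < \<epsilon>" for \<epsilon>
      using tendstoD[OF a(2) that] by (rule eventually_mono) (use u(1) in blast)
    then have "a \<in> A" using a(1) by (simp add: A_def)
    moreover have "(T ^^ i) a = x"
    proof (rule tendsto_unique[OF Fbot])
      show "((\<lambda>K. (T ^^ i) ((T ^^ m K) (u K))) \<longlongrightarrow> (T ^^ i) a) F"
        using inX by (intro iter_tendsto a)
      show "((\<lambda>K. (T ^^ i) ((T ^^ m K) (u K))) \<longlongrightarrow> x) F"
        by (rule tendsto_eventually, rule eventually_mono[OF i(2)]) (rule u(2))
    qed
    ultimately show "x \<in> (\<Union>i\<in>{1..N}. (T ^^ i) ` A)" using i(1) by blast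
  qed
  obtain i V where i: "i \<in> {1..N}" and V: "openin (top_of_set X) V" "V \<noteq> {}" "V \<subseteq> (T ^^ i) ` A"
    using nonempty_open_in_finite_closed_cover[OF finite_atLeastAtMost closed_image openin_subtopology_self X_nonempty cover]
    by blast
  \<comment> \<open>For \<open>F\<close>-almost all \<open>K\<close> the time \<open>m K + n\<close>
    lies in \<open>S\<close>, and in \<open>Th\<close> once \<open>K > n\<close>; there
    \<open>U\<close> has a small image, and the bound passes to the limit set
    \<open>A\<close>.\<close>
  have small: "dist ((T ^^ n) a) ((T ^^ n) b) \<le> \<delta>"
    if n: "1 \<le> n" "\<forall>\<^sub>F K in F. m K + n \<in> S" and ab: "a \<in> A" "b \<in> A" for n a b
  proof (rule field_le_epsilon)
    fix e :: real assume "0 < e"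
    then have "0 < e/2" by simp
    from iter_modulus[OF this, of n] obtain \<delta>' where \<delta>': "\<delta>' > 0"
      "\<And>x y. x \<in> X \<Longrightarrow> y \<in> X \<Longrightarrow> dist x y < \<delta>' \<Longrightarrow> dist ((T ^^ n) x) ((T ^^ n) y) < e/2" by blast
    have "\<forall>\<^sub>F K in F. \<exists>u\<in>U. dist ((T ^^ m K) u) a < \<delta>'" "\<forall>\<^sub>F K in F. \<exists>u\<in>U. dist ((T ^^ m K) u) b < \<delta>'"
      using ab \<delta>'(1) by (simp_all add: A_def)
    then have "\<forall>\<^sub>F K in F. m K + n \<in> S \<and> n < K \<and> (\<exists>u\<in>U. dist ((T ^^ m K) u) a < \<delta>') \<and> (\<exists>u\<in>U. dist ((T ^^ m K) u) b < \<delta>')"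
      using n(2) free_ultrafilter_tail[OF F eventually_gt_at_top[of n]] by (simp add: eventually_conj)
    then obtain K u v where K: "m K + n \<in> S" "n < K" and u: "u \<in> U" "dist ((T ^^ m K) u) a < \<delta>'"
      and v: "v \<in> U" "dist ((T ^^ m K) v) b < \<delta>'"
      using eventually_happens'[OF Fbot] by blast
    have "m K + n \<in> Th" using m[of K] K(2) by auto
    then have "m K + n \<notin> Nset T \<delta> U" using K(1) disj by blast
    then have "diameter ((T ^^ (m K + n)) ` U) \<le> \<delta>" using n(1) by (simp add: Nset_def)
    then have "dist ((T ^^ (m K + n)) u) ((T ^^ (m K + n)) v) \<le> \<delta>"
      using dist_le_diameter_iter[OF UX u(1) v(1), of "m K + n"] by simp
    then have "dist ((T ^^ n) ((T ^^ m K) u)) ((T ^^ n) ((T ^^ m K) v)) \<le> \<delta>"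
      by (simp add: add.commute[of "m K"] funpow_add)
    moreover have "dist ((T ^^ n) ((T ^^ m K) u)) ((T ^^ n) a) < e/2" "dist ((T ^^ n) ((T ^^ m K) v)) ((T ^^ n) b) < e/2"
      using \<delta>'(2)[OF iter_in[OF subsetD[OF UX u(1)]] subsetD[OF AX ab(1)] u(2)]
        \<delta>'(2)[OF iter_in[OF subsetD[OF UX v(1)]] subsetD[OF AX ab(2)] v(2)] by simp_all
    ultimately show "dist ((T ^^ n) a) ((T ^^ n) b) \<le> \<delta> + e"
      using dist_triangle[of "(T ^^ n) a" "(T ^^ n) b" "(T ^^ n) ((T ^^ m K) u)"]
        dist_triangle[of "(T ^^ n) ((T ^^ m K) u)" "(T ^^ n) b" "(T ^^ n) ((T ^^ m K) v)"]
      by (simp add: dist_commute)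
  qed
  obtain p where p: "{p..<p + L} \<subseteq> Nset T \<delta> V" using sens[OF V(1,2)] unfolding thick_def by blast
  \<comment> \<open>Each window of length \<open>L\<close> meets \<open>S\<close> at a place that
    depends on \<open>K\<close>; the ultrafilter fixes one \<open>n\<close>. The shift by
    \<open>i\<close> allows for \<open>V\<close> lying in the \<open>i\<close>-th image of
    \<open>A\<close>.\<close>
  have "\<exists>n\<in>{p + i..<p + i + L}. \<forall>\<^sub>F K in F. m K + n \<in> S"
  proof (intro free_ultrafilter_disj_finite[OF F] always_eventually allI)
    fix K
    obtain k where "k \<in> S" "m K + (p + i) \<le> k" "k < m K + (p + i) + L" using L by blast
    then show "\<exists>n\<in>{p + i..<p + i + L}. m K + n \<in> S" by (intro bexI[of _ "k - m K"]) auto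
  qed simp
  then obtain n where n: "p + i \<le> n" "n < p + i + L" "\<forall>\<^sub>F K in F. m K + n \<in> S" by auto
  have "n - i \<in> {p..<p + L}" using n(1,2) by auto
  then have "n - i \<in> Nset T \<delta> V" using p by blast
  then have "\<delta> < diameter ((T ^^ (n - i)) ` V)" by (simp add: Nset_def)
  moreover have "diameter ((T ^^ (n - i)) ` V) \<le> \<delta>"
  proof (rule diameter_le_dist)
    fix x y assume "x \<in> (T ^^ (n - i)) ` V" "y \<in> (T ^^ (n - i)) ` V"
    then obtain a b where ab: "a \<in> A" "b \<in> A" "x = (T ^^ (n - i)) ((T ^^ i) a)" "y = (T ^^ (n - i)) ((T ^^ i) b)"
      using V(3) by blast
    have "T ^^ n = T ^^ (n - i) \<circ> T ^^ i"
      using funpow_add[of "n - i" i T] n(1) by simp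
    then have "(T ^^ (n - i)) ((T ^^ i) c) = (T ^^ n) c" for c by simp
    then show "dist x y \<le> \<delta>" using small[OF _ n(3) ab(1,2)] ab(3,4) n(1) i by simp
  qed (use \<open>0 < \<delta>\<close> in simp)
  ultimately show False by simp
qed

end

section \<open>Large fibres force thick sensitivity\<close>

context minimal_max_eq_factor
begin

text \<open>\<open>fibre_from_close_pairs\<close> gives close points \<open>a\<close>,
  \<open>b\<close> which some \<open>T^n\<close> brings so near to \<open>x\<close>,
  \<open>z\<close> that they stay apart for \<open>L\<close> further steps. Being close, they enter
  \<open>U\<close> under a common earlier iterate, so these steps become an interval of
  \<open>Nset\<close>.\<close>

lemma nonproximal_fibre_pair_imp_thick:
  assumes xz: "x \<in> X" "z \<in> X" "\<pi> x = \<pi> z" and "0 < \<epsilon>"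
    and far: "\<And>n. \<epsilon> \<le> dist ((T ^^ n) x) ((T ^^ n) z)"
    and U: "openin (top_of_set X) U" "U \<noteq> {}"
  shows "thick (Nset T (\<epsilon>/2) U)"
  unfolding thick_def
proof
  fix L
  have UX: "U \<subseteq> X" using U(1) by (rule openin_imp_subset)
  obtain N \<rho> where \<rho>: "\<rho> > 0"
    "\<And>A. A \<subseteq> X \<Longrightarrow> A \<noteq> {} \<Longrightarrow> (\<forall>a\<in>A. \<forall>b\<in>A. dist a b < \<rho>) \<Longrightarrow> \<exists>j<N. (T ^^ j) ` A \<subseteq> U"
    using uniform_return_cover[OF U] by metis
  \<comment> \<open>\<open>\<epsilon>/4\<close> is lost at either end, leaving
    \<open>\<epsilon>/2\<close>; \<open>\<epsilon>/3\<close> serves to show that \<open>n\<close>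
    exceeds \<open>N\<close>.\<close>
  have e: "0 < \<epsilon>/3" "0 < \<epsilon>/4" using \<open>0 < \<epsilon>\<close> by simp_all
  obtain \<rho>' where \<rho>': "\<rho>' > 0" "\<And>k a b. k \<le> N \<Longrightarrow> a \<in> X \<Longrightarrow> b \<in> X \<Longrightarrow> dist a b < \<rho>' \<Longrightarrow> dist ((T ^^ k) a) ((T ^^ k) b) < \<epsilon>/3"
    using iter_modulus[OF e(1), of N] by metis
  obtain \<eta> where \<eta>: "\<eta> > 0" "\<And>k a b. k \<le> L \<Longrightarrow> a \<in> X \<Longrightarrow> b \<in> X \<Longrightarrow> dist a b < \<eta> \<Longrightarrow> dist ((T ^^ k) a) ((T ^^ k) b) < \<epsilon>/4"
    using iter_modulus[OF e(2), of L] by metis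
  have "0 < min \<rho> \<rho>'" "0 < min \<eta> (\<epsilon>/3)" using \<rho>(1) \<rho>'(1) \<eta>(1) e(1) by simp_all
  from fibre_from_close_pairs[OF xz this] obtain a b n where ab: "a \<in> X" "b \<in> X" "dist a b < min \<rho> \<rho>'"
    "dist ((T ^^ n) a) x < min \<eta> (\<epsilon>/3)" "dist ((T ^^ n) b) z < min \<eta> (\<epsilon>/3)" by blast
  \<comment> \<open>\<open>\<rho>'\<close> keeps \<open>a\<close> and \<open>b\<close> together for
    \<open>N\<close> steps, whereas at time \<open>n\<close> they are apart; so the entrance into
    \<open>U\<close> comes first.\<close>
  have "N < n"
  proof (rule ccontr)
    assume "\<not> N < n"
    then have "dist ((T ^^ n) a) ((T ^^ n) b) < \<epsilon>/3" using \<rho>'(2) ab by simp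
    moreover have "\<epsilon> \<le> dist x z" using far[of 0] by simp
    ultimately show False
      using ab(4,5) dist_triangle[of x z "(T ^^ n) a"] dist_triangle[of "(T ^^ n) a" z "(T ^^ n) b"]
      by (simp add: dist_commute)
  qed
  have "\<exists>j<N. (T ^^ j) ` {a, b} \<subseteq> U"
    using ab(1-3) \<rho>(1) by (intro \<rho>(2)) (auto simp: dist_commute)
  then obtain j where j: "j < N" "(T ^^ j) a \<in> U" "(T ^^ j) b \<in> U" by auto
  have "n - j + i \<in> Nset T (\<epsilon>/2) U" if "i < L" for i
  proof (rule mem_Nset[OF UX j(2,3)])
    show "1 \<le> n - j + i" using \<open>N < n\<close> j(1) by simp
    have "(T ^^ (n - j + i)) ((T ^^ j) c) = (T ^^ i) ((T ^^ n) c)" for c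
    proof -
      have "(T ^^ (n - j + i)) ((T ^^ j) c) = (T ^^ (n - j + i + j)) c" by (simp add: funpow_add)
      also have "n - j + i + j = i + n" using \<open>N < n\<close> j(1) by simp
      finally show ?thesis by (simp add: funpow_add)
    qed
    moreover have "dist ((T ^^ i) ((T ^^ n) a)) ((T ^^ i) x) < \<epsilon>/4" "dist ((T ^^ i) ((T ^^ n) b)) ((T ^^ i) z) < \<epsilon>/4"
      using \<eta>(2)[OF less_imp_le[OF that]] ab iter_in xz by simp_all
    ultimately show "\<epsilon>/2 < dist ((T ^^ (n - j + i)) ((T ^^ j) a)) ((T ^^ (n - j + i)) ((T ^^ j) b))"
      using far[of i] dist_triangle[of "(T ^^ i) x" "(T ^^ i) z" "(T ^^ i) ((T ^^ n) a)"]
        dist_triangle[of "(T ^^ i) ((T ^^ n) a)" "(T ^^ i) z" "(T ^^ i) ((T ^^ n) b)"]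
      by (simp add: dist_commute)
  qed
  then have "{n - j..<n - j + L} \<subseteq> Nset T (\<epsilon>/2) U"
    by (metis atLeastLessThan_iff le_add_diff_inverse nat_add_left_cancel_less subsetI)
  then show "\<exists>m. {m..<m + L} \<subseteq> Nset T (\<epsilon>/2) U" by blast
qed

lemma fibre_limits_eq:
  assumes "F \<noteq> bot" "(f \<longlongrightarrow> u) F" "(g \<longlongrightarrow> v) F" "\<And>n. f n \<in> X" "\<And>n. g n \<in> X" "u \<in> X" "v \<in> X"
    and "\<And>n. \<pi> (f n) = \<pi> (g n)"
  shows "\<pi> u = \<pi> v"
proof (rule tendsto_unique[OF assms(1)])
  show "((\<lambda>n. \<pi> (f n)) \<longlongrightarrow> \<pi> u) F"
    using assms(4) by (intro continuous_on_tendsto_compose[OF \<pi>_cont assms(2,6)]) simp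
  have "((\<lambda>n. \<pi> (g n)) \<longlongrightarrow> \<pi> v) F"
    using assms(5) by (intro continuous_on_tendsto_compose[OF \<pi>_cont assms(3,7)]) simp
  then show "((\<lambda>n. \<pi> (f n)) \<longlongrightarrow> \<pi> v) F" by (simp add: assms(8))
qed

text \<open>Induction on the number of points: along times that collapse the first \<open>k\<close>
  points, these tend to one limit \<open>w\<close> and the last to some \<open>w'\<close> in the
  same fibre; an iterate that brings \<open>w\<close> and \<open>w'\<close> together does so for all
  points near them.\<close>

lemma fibre_tuple_proximal:
  fixes p :: "nat \<Rightarrow> 'a"
  assumes prox: "\<And>x z \<epsilon>. x \<in> X \<Longrightarrow> z \<in> X \<Longrightarrow> \<pi> x = \<pi> z \<Longrightarrow> 0 < \<epsilon> \<Longrightarrow> \<exists>n. dist ((T ^^ n) x) ((T ^^ n) z) < \<epsilon>"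
    and p: "\<And>i. i < k \<Longrightarrow> p i \<in> X \<and> \<pi> (p i) = y" and "0 < \<epsilon>"
  shows "\<exists>n. \<forall>i<k. \<forall>j<k. dist ((T ^^ n) (p i)) ((T ^^ n) (p j)) < \<epsilon>"
  using p \<open>0 < \<epsilon>\<close>
proof (induction k arbitrary: \<epsilon>)
  case (Suc k)
  show ?case
  \<comment> \<open>The limit \<open>w\<close> is taken along \<open>p 0\<close>, which must be
    among the first \<open>k\<close> points.\<close>
  proof (cases "k = 0")
    case True
    then show ?thesis using Suc.prems(2) by (intro exI[of _ 0]) auto
  next
    case False
    have pX: "p i \<in> X" "\<pi> (p i) = y" if "i \<le> k" for i using Suc.prems(1)[of i] that by simp_all
    have "\<exists>n. \<forall>i<k. \<forall>j<k. dist ((T ^^ n) (p i)) ((T ^^ n) (p j)) < inverse (real (Suc l))" for l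
      using Suc.prems(1) by (intro Suc.IH) auto
    then obtain n where n: "\<And>l i j. i < k \<Longrightarrow> j < k \<Longrightarrow> dist ((T ^^ n l) (p i)) ((T ^^ n l) (p j)) < inverse (real (Suc l))"
      by metis
    obtain F where F: "free_ultrafilter F" using free_ultrafilter_exists by blast
    then have Fbot: "F \<noteq> bot" by (simp add: free_ultrafilter_def)
    have inX: "(T ^^ n l) (p i) \<in> X" if "i \<le> k" for l i using pX(1)[OF that] by (rule iter_in)
    obtain w where w: "w \<in> X" "((\<lambda>l. (T ^^ n l) (p 0)) \<longlongrightarrow> w) F"
      using free_ultrafilter_compact_limit[OF F compact_X, of "\<lambda>l. (T ^^ n l) (p 0)"] inX by auto
    obtain w' where w': "w' \<in> X" "((\<lambda>l. (T ^^ n l) (p k)) \<longlongrightarrow> w') F"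
      using free_ultrafilter_compact_limit[OF F compact_X, of "\<lambda>l. (T ^^ n l) (p k)"] inX by auto
    have "\<pi> w = \<pi> w'"
      using pX inX by (intro fibre_limits_eq[OF Fbot w(2) w'(2) _ _ w(1) w'(1)]) (simp_all add: \<pi>_iter)
    have "0 < \<epsilon>/3" using Suc.prems(2) by simp
    then obtain m where m: "dist ((T ^^ m) w) ((T ^^ m) w') < \<epsilon>/3"
      using prox[OF w(1) w'(1) \<open>\<pi> w = \<pi> w'\<close>] by blast
    define c where "c i = (if i < k then w else w')" for i
    have cX: "c i \<in> X" for i using w w' by (simp add: c_def)
    have c_near: "dist ((T ^^ m) (c i)) ((T ^^ m) (c j)) < \<epsilon>/3" for i j
      using m \<open>0 < \<epsilon>/3\<close> by (simp add: c_def dist_commute)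
    have lim: "((\<lambda>l. (T ^^ n l) (p i)) \<longlongrightarrow> c i) F" if "i \<le> k" for i
    proof (cases "i < k")
      case True
      show ?thesis
      proof (rule tendstoI)
        fix e :: real assume "0 < e"
        then have "0 < e/2" by simp
        have "\<forall>\<^sub>F l in sequentially. inverse (real (Suc l)) < e/2"
          by (rule order_tendstoD(2)[OF LIMSEQ_inverse_real_of_nat \<open>0 < e/2\<close>])
        from free_ultrafilter_tail[OF F this] tendstoD[OF w(2) \<open>0 < e/2\<close>]
        show "\<forall>\<^sub>F l in F. dist ((T ^^ n l) (p i)) (c i) < e"
        proof eventually_elim
          case (elim l)
          have "dist ((T ^^ n l) (p i)) ((T ^^ n l) (p 0)) < inverse (real (Suc l))"
            using n True False by simp
          then show ?case
            using elim True dist_triangle[of "(T ^^ n l) (p i)" w "(T ^^ n l) (p 0)"] by (simp add: c_def)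
        qed
      qed
    next
      case False
      then show ?thesis using w' that by (simp add: c_def)
    qed
    have "\<forall>i\<in>{..k}. \<forall>\<^sub>F l in F. dist ((T ^^ m) ((T ^^ n l) (p i))) ((T ^^ m) (c i)) < \<epsilon>/3"
    proof
      fix i assume i: "i \<in> {..k}"
      have "((\<lambda>l. (T ^^ m) ((T ^^ n l) (p i))) \<longlongrightarrow> (T ^^ m) (c i)) F"
        using i inX by (intro iter_tendsto lim cX) auto
      then show "\<forall>\<^sub>F l in F. dist ((T ^^ m) ((T ^^ n l) (p i))) ((T ^^ m) (c i)) < \<epsilon>/3"
        using \<open>0 < \<epsilon>/3\<close> by (rule tendstoD)
    qed
    then have "\<forall>\<^sub>F l in F. \<forall>i\<in>{..k}. dist ((T ^^ m) ((T ^^ n l) (p i))) ((T ^^ m) (c i)) < \<epsilon>/3"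
      by (simp add: eventually_ball_finite)
    then obtain l where l: "\<And>i. i \<le> k \<Longrightarrow> dist ((T ^^ m) ((T ^^ n l) (p i))) ((T ^^ m) (c i)) < \<epsilon>/3"
      using eventually_happens'[OF Fbot] by blast
    have "dist ((T ^^ (m + n l)) (p i)) ((T ^^ (m + n l)) (p j)) < \<epsilon>" if "i < Suc k" "j < Suc k" for i j
    proof -
      let ?q = "\<lambda>i. (T ^^ m) ((T ^^ n l) (p i))"
      have "dist (?q i) (?q j) < \<epsilon>"
        using l[of i] l[of j] that c_near[of i j] dist_triangle[of "?q i" "?q j" "(T ^^ m) (c i)"]
          dist_triangle[of "(T ^^ m) (c i)" "?q j" "(T ^^ m) (c j)"] by (simp add: dist_commute)
      then show ?thesis by (simp add: funpow_add)
    qed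
    then show ?thesis by blast
  qed
qed simp

text \<open>A finite part \<open>p\<close> of one fibre that stays spread out for \<open>L\<close> steps is followed along backward
  orbits. A limit of these is again contained in one fibre, so it collapses under some \<open>T^m\<close>;
  hence \<open>p\<close> is the image of arbitrarily small sets under arbitrarily high iterates of \<open>T\<close>.\<close>

lemma proximal_large_fibres_imp_thick:
  assumes prox: "\<And>x z \<epsilon>. x \<in> X \<Longrightarrow> z \<in> X \<Longrightarrow> \<pi> x = \<pi> z \<Longrightarrow> 0 < \<epsilon> \<Longrightarrow> \<exists>n. dist ((T ^^ n) x) ((T ^^ n) z) < \<epsilon>"
    and large: "\<And>x. x \<in> X \<Longrightarrow> \<exists>y\<in>X. \<pi> x = \<pi> y \<and> \<delta> < dist x y"
    and U: "openin (top_of_set X) U" "U \<noteq> {}"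
  shows "thick (Nset T \<delta> U)"
  unfolding thick_def
proof
  fix L
  have UX: "U \<subseteq> X" using U(1) by (rule openin_imp_subset)
  obtain N \<rho> where \<rho>: "\<rho> > 0"
    "\<And>A. A \<subseteq> X \<Longrightarrow> A \<noteq> {} \<Longrightarrow> (\<forall>a\<in>A. \<forall>b\<in>A. dist a b < \<rho>) \<Longrightarrow> \<exists>j<N. (T ^^ j) ` A \<subseteq> U"
    using uniform_return_cover[OF U] by metis
  obtain x where x: "x \<in> X" using X_nonempty by blast
  \<comment> \<open>A point far from \<open>T^i x\<close> in its fibre is lifted to a partner of
    \<open>x\<close>, apart from \<open>x\<close> at time \<open>i\<close>.\<close>
  have "\<exists>q\<in>X. \<pi> q = \<pi> x \<and> \<delta> < dist ((T ^^ i) x) ((T ^^ i) q)" for i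
  proof -
    obtain y where y: "y \<in> X" "\<pi> ((T ^^ i) x) = \<pi> y" "\<delta> < dist ((T ^^ i) x) y"
      using large[OF iter_in[OF x]] by blast
    then show ?thesis using fibre_lift[OF x y(1), of i] by auto
  qed
  then obtain q where q: "\<And>i. q i \<in> X" "\<And>i. \<pi> (q i) = \<pi> x" "\<And>i. \<delta> < dist ((T ^^ i) x) ((T ^^ i) (q i))"
    by metis
  \<comment> \<open>\<open>p 0\<close> is \<open>x\<close> itself and \<open>p (Suc i)\<close> its
    partner for time \<open>i\<close>, so \<open>L\<close> times need the indices up to
    \<open>L\<close>.\<close>
  define p where "p = case_nat x q"
  have p: "p i \<in> X" "\<pi> (p i) = \<pi> x" for i using x q by (simp_all add: p_def split: nat.split)
  define b where "b n i = (inv_into X T ^^ n) (p i)" for n i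
  have bX: "b n i \<in> X" for n i unfolding b_def by (rule backward_orbit(1)[OF T_image p(1)])
  have Tb: "(T ^^ k) (b (k + n) i) = b n i" for k n i
    unfolding b_def by (rule backward_orbit(2)[OF T_image p(1)])
  have b_fibre: "\<pi> (b n i) = \<pi> (b n j)" for n i j
  proof (rule S_iter_inj[OF \<pi>_in[OF bX] \<pi>_in[OF bX]])
    have "(S ^^ n) (\<pi> (b n k)) = \<pi> x" for k
      using \<pi>_iter[OF bX[of n k], of n] Tb[of n 0 k] p(2)[of k] by (simp add: b_def)
    then show "(S ^^ n) (\<pi> (b n i)) = (S ^^ n) (\<pi> (b n j))" by simp
  qed
  obtain F where F: "free_ultrafilter F" using free_ultrafilter_exists by blast
  then have Fbot: "F \<noteq> bot" by (simp add: free_ultrafilter_def)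
  have "\<exists>l\<in>X. ((\<lambda>n. b n i) \<longlongrightarrow> l) F" for i
    using bX by (intro free_ultrafilter_compact_limit[OF F compact_X])
  then obtain u where u: "\<And>i. u i \<in> X" "\<And>i. ((\<lambda>n. b n i) \<longlongrightarrow> u i) F" by metis
  have u_fibre: "\<pi> (u i) = \<pi> (u 0)" for i
    by (rule fibre_limits_eq[OF Fbot u(2) u(2) bX bX u(1) u(1) b_fibre])
  have "\<exists>m. \<forall>i<Suc L. \<forall>j<Suc L. dist ((T ^^ m) (u i)) ((T ^^ m) (u j)) < \<rho>"
    using u(1) u_fibre \<rho>(1) by (intro fibre_tuple_proximal[OF prox, where y = "\<pi> (u 0)"]) auto
  then obtain m where m: "\<And>i j. i \<le> L \<Longrightarrow> j \<le> L \<Longrightarrow> dist ((T ^^ m) (u i)) ((T ^^ m) (u j)) < \<rho>"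
    by (auto simp: less_Suc_eq_le)
  have "\<forall>i\<in>{..L}. \<forall>j\<in>{..L}. \<forall>\<^sub>F n in F. dist ((T ^^ m) (b n i)) ((T ^^ m) (b n j)) < \<rho>"
  proof (intro ballI)
    fix i j assume "i \<in> {..L}" "j \<in> {..L}"
    then have "dist ((T ^^ m) (u i)) ((T ^^ m) (u j)) < \<rho>" using m by simp
    then show "\<forall>\<^sub>F n in F. dist ((T ^^ m) (b n i)) ((T ^^ m) (b n j)) < \<rho>"
      by (rule order_tendstoD(2)[OF tendsto_dist[OF iter_tendsto[OF u(2) bX u(1)] iter_tendsto[OF u(2) bX u(1)]]])
  qed
  then have "\<forall>\<^sub>F n in F. \<forall>i\<in>{..L}. \<forall>j\<in>{..L}. dist ((T ^^ m) (b n i)) ((T ^^ m) (b n j)) < \<rho>"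
    by (simp add: eventually_ball_finite)
  then have "\<forall>\<^sub>F n in F. m + N \<le> n \<and> (\<forall>i\<in>{..L}. \<forall>j\<in>{..L}. dist ((T ^^ m) (b n i)) ((T ^^ m) (b n j)) < \<rho>)"
    using free_ultrafilter_tail[OF F eventually_ge_at_top[of "m + N"]] by (simp add: eventually_conj)
  then obtain n where n: "m + N \<le> n" "\<forall>i\<in>{..L}. \<forall>j\<in>{..L}. dist ((T ^^ m) (b n i)) ((T ^^ m) (b n j)) < \<rho>"
    using eventually_happens'[OF Fbot] by blast
  \<comment> \<open>\<open>T^m\<close> moves the backward orbits from depth \<open>n\<close> to
    depth \<open>M\<close>; \<open>N \<le> M\<close> leaves time to enter \<open>U\<close> before
    \<open>p\<close> is reached.\<close>
  define M where "M = n - m"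
  have M: "n = m + M" "N \<le> M" using n(1) by (simp_all add: M_def)
  have near: "dist (b M i) (b M j) < \<rho>" if "i \<le> L" "j \<le> L" for i j
    using n(2) that by (simp add: M(1) Tb)
  have "\<exists>j<N. (T ^^ j) ` (b M ` {..L}) \<subseteq> U"
    using bX near by (intro \<rho>(2)) auto
  then obtain j where j: "j < N" "\<And>i. i \<le> L \<Longrightarrow> (T ^^ j) (b M i) \<in> U" by (auto simp: subset_iff)
  have "M - j + i \<in> Nset T \<delta> U" if "i < L" for i
  proof (rule mem_Nset[OF UX j(2) j(2)])
    show "0 \<le> L" "Suc i \<le> L" using that by simp_all
    show "1 \<le> M - j + i" using M(2) j(1) by simp
    have "(T ^^ (M - j + i)) ((T ^^ j) (b M k)) = (T ^^ i) (p k)" for k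
    proof -
      have "(T ^^ (M - j + i)) ((T ^^ j) (b M k)) = (T ^^ (M - j + i + j)) (b M k)" by (simp add: funpow_add)
      also have "M - j + i + j = i + M" using M(2) j(1) by simp
      finally show ?thesis using Tb[of M 0 k] by (simp add: funpow_add b_def)
    qed
    then show "\<delta> < dist ((T ^^ (M - j + i)) ((T ^^ j) (b M 0))) ((T ^^ (M - j + i)) ((T ^^ j) (b M (Suc i))))"
      using q(3)[of i] by (simp add: p_def)
  qed
  then have "{M - j..<M - j + L} \<subseteq> Nset T \<delta> U"
    by (metis atLeastLessThan_iff le_add_diff_inverse nat_add_left_cancel_less subsetI)
  then show "\<exists>m. {m..<m + L} \<subseteq> Nset T \<delta> U" by blast
qed

text \<open>Either every fibre pair is proximal, or some fibre pair stays apart; each case has its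
  own sensitivity constant.\<close>

lemma not_almost_one_to_one_imp_thick_sensitive:
  assumes "\<not> almost_one_to_one X \<pi>"
  shows "F_sensitive X T thick"
proof -
  obtain \<delta> where \<delta>: "\<delta> > 0" "\<And>x. x \<in> X \<Longrightarrow> \<exists>y\<in>X. \<pi> x = \<pi> y \<and> \<delta> < dist x y"
    using not_almost_one_to_one_imp_large_fibres[OF assms] by blast
  show ?thesis
  proof (cases "\<forall>x\<in>X. \<forall>z\<in>X. \<pi> x = \<pi> z \<longrightarrow> (\<forall>\<epsilon>>0. \<exists>n. dist ((T ^^ n) x) ((T ^^ n) z) < \<epsilon>)")
    case True
    then have "thick (Nset T \<delta> U)" if "openin (top_of_set X) U" "U \<noteq> {}" for U
      using proximal_large_fibres_imp_thick[OF _ \<delta>(2) that] by blast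
    then show ?thesis unfolding F_sensitive_def using \<delta>(1) by blast
  next
    case False
    then obtain x z \<epsilon> where xz: "x \<in> X" "z \<in> X" "\<pi> x = \<pi> z" "0 < \<epsilon>" "\<And>n. \<epsilon> \<le> dist ((T ^^ n) x) ((T ^^ n) z)"
      by (meson not_le)
    have "thick (Nset T (\<epsilon>/2) U)" if "openin (top_of_set X) U" "U \<noteq> {}" for U
      by (rule nonproximal_fibre_pair_imp_thick[OF xz that])
    moreover have "0 < \<epsilon>/2" using xz(4) by simp
    ultimately show ?thesis unfolding F_sensitive_def by blast
  qed
qed

end

section \<open>Monotonicity in the family and the cycle of implications\<close>

lemma F_sensitive_mono:
  assumes "F_sensitive X T \<F>" "\<And>A. \<F> A \<Longrightarrow> \<G> A"
  shows "F_sensitive X T \<G>"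
proof -
  obtain \<delta> where "\<delta> > 0" "\<forall>U. openin (top_of_set X) U \<and> U \<noteq> {} \<longrightarrow> \<F> (Nset T \<delta> U)"
    using assms(1) unfolding F_sensitive_def by blast
  then have "\<forall>U. openin (top_of_set X) U \<and> U \<noteq> {} \<longrightarrow> \<G> (Nset T \<delta> U)"
    using assms(2) by simp
  then show ?thesis using \<open>\<delta> > 0\<close> unfolding F_sensitive_def by blast
qed

theorem theorem3p2:
  fixes X :: "'a::metric_space set" and T :: "'a \<Rightarrow> 'a"
    and Y :: "'b::metric_space set" and S :: "'b \<Rightarrow> 'b" and \<pi> :: "'a \<Rightarrow> 'b"
  assumes "tds X T" and "minimal_sys X T"
    and "max_eq_factor X T Y S \<pi>"
  shows "(F_sensitive X T thickly_syndetic \<longleftrightarrow> F_sensitive X T thick)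
       \<and> (F_sensitive X T thick \<longleftrightarrow> F_sensitive X T ip_family)
       \<and> (F_sensitive X T ip_family \<longleftrightarrow> F_sensitive X T fip_family)
       \<and> (F_sensitive X T fip_family \<longleftrightarrow> F_sensitive X T fDelta_family)
       \<and> (F_sensitive X T fDelta_family \<longleftrightarrow>
            (\<exists>\<delta>>0. \<forall>x\<in>X. \<exists>y\<in>X. regionally_proximal X T x y \<and> dist x y > \<delta>))
       \<and> ((\<exists>\<delta>>0. \<forall>x\<in>X. \<exists>y\<in>X. regionally_proximal X T x y \<and> dist x y > \<delta>)
            \<longleftrightarrow> \<not> almost_one_to_one X \<pi>)"
proof -
  interpret minimal_max_eq_factor X T Y S \<pi>
    by (intro minimal_max_eq_factor.intro minimal_tds.intro minimal_max_eq_factor_axioms.intro assms)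
  let ?RP = "\<exists>\<delta>>0. \<forall>x\<in>X. \<exists>y\<in>X. regionally_proximal X T x y \<and> dist x y > \<delta>"
  have one_to_one_point: "\<exists>x\<in>X. {x' \<in> X. \<pi> x' = \<pi> x} = {x}" if "almost_one_to_one X \<pi>"
  proof (rule ccontr)
    assume "\<not> ?thesis"
    then have empty: "{x \<in> X. {x' \<in> X. \<pi> x' = \<pi> x} = {x}} = {}" by simp
    have "X \<subseteq> closure {}"
      using that unfolding almost_one_to_one_def empty .
    then show False using X_nonempty by simp
  qed
  \<comment> \<open>The family conditions form a chain, which the failure of
    \<open>almost_one_to_one\<close> closes to a cycle; the regionally proximal condition is
    attached to that failure in both directions.\<close>
  have ts_thick: "F_sensitive X T thick" if "F_sensitive X T thickly_syndetic"
    using that by (rule F_sensitive_mono) (rule thickly_syndetic_imp_thick)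
  have thick_ip: "F_sensitive X T ip_family" if "F_sensitive X T thick"
    using that by (rule F_sensitive_mono) (rule thick_imp_ip_family)
  have ip_fip: "F_sensitive X T fip_family" if "F_sensitive X T ip_family"
    using that by (rule F_sensitive_mono) (rule ip_family_imp_fip_family)
  have fip_fDelta: "F_sensitive X T fDelta_family" if "F_sensitive X T fip_family"
    using that by (rule F_sensitive_mono) (rule fip_family_imp_fDelta_family)
  have fDelta_fibres: "\<not> almost_one_to_one X \<pi>" if "F_sensitive X T fDelta_family"
    using singleton_fibre_not_fDelta_sensitive one_to_one_point that by blast
  have fibres_ts: "F_sensitive X T thickly_syndetic" if fibres: "\<not> almost_one_to_one X \<pi>"
  proof -
    obtain \<delta> where "\<delta> > 0" "\<And>U. openin (top_of_set X) U \<Longrightarrow> U \<noteq> {} \<Longrightarrow> thick (Nset T \<delta> U)"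
      using not_almost_one_to_one_imp_thick_sensitive[OF fibres] unfolding F_sensitive_def by blast
    then have "\<forall>U. openin (top_of_set X) U \<and> U \<noteq> {} \<longrightarrow> thickly_syndetic (Nset T \<delta> U)"
      by (intro allI impI thick_sensitive_imp_thickly_syndetic) auto
    then show ?thesis unfolding F_sensitive_def using \<open>\<delta> > 0\<close> by blast
  qed
  have fibres_RP: ?RP if "\<not> almost_one_to_one X \<pi>"
    using not_almost_one_to_one_imp_large_fibres[OF that] fibre_imp_regionally_proximal by meson
  have RP_fibres: "\<not> almost_one_to_one X \<pi>" if RP: ?RP
  proof
    assume "almost_one_to_one X \<pi>"
    then obtain x where x: "x \<in> X" "{x' \<in> X. \<pi> x' = \<pi> x} = {x}" using one_to_one_point by blast
    obtain y where y: "y \<in> X" "regionally_proximal X T x y" "0 < dist x y"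
      using RP x(1) by (meson order_less_trans)
    then have "y \<in> {x' \<in> X. \<pi> x' = \<pi> x}" using regionally_proximal_imp_fibre by simp
    then show False using x(2) y(3) by simp
  qed
  show ?thesis
    using ts_thick thick_ip ip_fip fip_fDelta fDelta_fibres fibres_ts fibres_RP RP_fibres by blast
qed

end
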